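(* Let $A\in\mathbb{R}^{n\times n}$, $n\ge 2$, be a Type-IV bdsw matrix. Let $k$, $1\le k<n$, be the number of negative diagonal entries in $A$. Then the following are equivalent: (i) $A\in\mathbf{Q}$. (ii) $(-1)^{k+1}\det A>0$. (iii) $A\in\mathbf{R}_0$ and $\deg A=\pm 1$.
   Context: A matrix $A=[a_{ij}]\in\mathbb{R}^{n\times n}$, $n\ge 2$, is a bidiagonal southwest (bdsw) matrix if $a_{ij}=0$ unless $j=i$, or $j=i+1$, or $(i,j)=(n,1)$. In row $i<n$ the relevant off-diagonal entry is $a_{i(i+1)}$; in row $n$ it is $a_{n1}$. A Type-IV bdsw matrix is a bdsw matrix which contains no nonnegative row and no nonpositive row, has at least one row with a positive diagonal entry, and has at least one row with a negative diagonal entry (so in each row the diagonal entry and the relevant off-diagonal entry are nonzero with opposite signs). For $A\in\mathbb{R}^{n\times n}$ and $q\in\mathbb{R}^n$, $\mathrm{LCP}(A,q)$ is the problem of finding $x\in\mathbb{R}^n$ with $x\ge 0$, $Ax+q\ge 0$ and $x^\top(Ax+q)=0$ (componentwise inequalities). $A\in\mathbf{Q}$ if $\mathrm{LCP}(A,q)$ has a solution for every $q\in\mathbb{R}^n$. $A\in\mathbf{R}_0$ if $x=0$ is the only solution of $\mathrm{LCP}(A,0)$. For $A\in\mathbf{R}_0$, let $f(x):=\min\{x,Ax\}$ (componentwise minimum) on $\mathbb{R}^n$; then $f(x)=0$ only for $x=0$, and $\deg A:=\deg(f,\Omega,0)$ is the topological (Brouwer) degree of $f$ at $0$ relative to any bounded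 open set $\Omega\subset\mathbb{R}^n$ containing $0$. *)

theory Defs
  imports
    "HOL-Homology.Homology"
    "Jordan_Normal_Form.Determinant"
begin

unbundle no inner_syntax
unbundle no vec_syntax

section \<open>Bidiagonal southwest matrices\<close>

text \<open>
  Rows and columns are numbered from \<open>0\<close> to \<open>n - 1\<close>, so that the southwest corner is
  the entry \<open>(n - 1, 0)\<close>.
\<close>

definition bdsw :: "real mat \<Rightarrow> bool" where
  "bdsw A \<longleftrightarrow> square_mat A \<and> 2 \<le> dim_row A \<and>
     (\<forall>i<dim_row A. \<forall>j<dim_row A.
        A $$ (i, j) \<noteq> 0 \<longrightarrow> j = i \<or> j = i + 1 \<or> (i = dim_row A - 1 \<and> j = 0))"

definition type_IV_bdsw :: "real mat \<Rightarrow> bool" where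
  "type_IV_bdsw A \<longleftrightarrow> bdsw A \<and>
     (\<forall>i<dim_row A. \<not> (\<forall>j<dim_col A. A $$ (i, j) \<ge> 0)) \<and>
     (\<forall>i<dim_row A. \<not> (\<forall>j<dim_col A. A $$ (i, j) \<le> 0)) \<and>
     (\<exists>i<dim_row A. A $$ (i, i) > 0) \<and>
     (\<exists>i<dim_row A. A $$ (i, i) < 0)"

section \<open>The linear complementarity problem\<close>

definition LCP_solution :: "real mat \<Rightarrow> real vec \<Rightarrow> real vec \<Rightarrow> bool" where
  "LCP_solution A q x \<longleftrightarrow> x \<in> carrier_vec (dim_col A) \<and>
     0\<^sub>v (dim_col A) \<le> x \<and> 0\<^sub>v (dim_row A) \<le> A *\<^sub>v x + q \<and> x \<bullet> (A *\<^sub>v x + q) = 0"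

definition Q_matrix :: "real mat \<Rightarrow> bool" where
  "Q_matrix A \<longleftrightarrow> (\<forall>q\<in>carrier_vec (dim_row A). \<exists>x. LCP_solution A q x)"

definition R0_matrix :: "real mat \<Rightarrow> bool" where
  "R0_matrix A \<longleftrightarrow> (\<forall>x. LCP_solution A (0\<^sub>v (dim_row A)) x \<longleftrightarrow> x = 0\<^sub>v (dim_col A))"

section \<open>The Brouwer degree relative to a bounded open set\<close>

text \<open>
  Here \<open>\<real>\<^sup>n\<close> is \<^const>\<open>Euclidean_space\<close> \<open>n\<close>: the functions \<open>nat \<Rightarrow> real\<close> that vanish
  from index \<open>n\<close> on. The library has the degree of a self-map of the sphere
  \<^const>\<open>nsphere\<close> \<open>n\<close> in \<open>\<real>\<^bsup>n+1\<^esup>\<close>. The degree of \<open>f\<close> at \<open>y\<close> relative to \<open>\<Omega>\<close> is obtained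
  from it through the one-point compactification.

  The last coordinate, with index \<open>n\<close>, is the height on the sphere. Stereographic projection from
  the north pole identifies \<open>\<real>\<^sup>n\<close> with the sphere minus that pole, and \<open>ball_collapse\<close>
  maps the open unit ball homeomorphically onto the sphere minus that pole, with the same
  orientation, and everything outside the ball to the pole.
\<close>

definition enorm :: "nat \<Rightarrow> (nat \<Rightarrow> real) \<Rightarrow> real" where
  "enorm n x = sqrt (\<Sum>i<n. (x i)\<^sup>2)"

definition north_pole :: "nat \<Rightarrow> nat \<Rightarrow> real" where
  "north_pole n = (\<lambda>i. if i = n then 1 else 0)"

definition stereographic :: "nat \<Rightarrow> (nat \<Rightarrow> real) \<Rightarrow> nat \<Rightarrow> real" where
  "stereographic n p = (\<lambda>i. if i < n then p i / (1 - p n) else 0)"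

definition ball_collapse :: "nat \<Rightarrow> (nat \<Rightarrow> real) \<Rightarrow> nat \<Rightarrow> real" where
  "ball_collapse n w =
     (if enorm n w < 1
      then (\<lambda>i. if i < n then 2 * sqrt (1 - (enorm n w)\<^sup>2) * w i
                else if i = n then 2 * (enorm n w)\<^sup>2 - 1 else 0)
      else north_pole n)"

text \<open>
  Let \<open>r\<close> be the value of \<open>deg_radius\<close>, the distance from \<open>y\<close> to the image of the boundary
  of \<open>\<Omega>\<close>. The sphere map sends
  \<open>x \<in> \<Omega>\<close> to the collapse of \<open>(f x - y) / r\<close> and every other point, including infinity,
  to the pole. It is continuous if \<open>f\<close> is continuous on the closure of the bounded open set
  \<open>\<Omega>\<close> and \<open>y\<close> is not in the image of its boundary, and over the preimage of the open
  \<open>r\<close>-ball around \<open>y\<close> it is \<open>f\<close> up to the identifications above. Hence its degree is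
  the degree of \<open>f\<close> at \<open>y\<close>.
\<close>

definition deg_radius ::
  "nat \<Rightarrow> ((nat \<Rightarrow> real) \<Rightarrow> nat \<Rightarrow> real) \<Rightarrow> (nat \<Rightarrow> real) set \<Rightarrow> (nat \<Rightarrow> real) \<Rightarrow> real" where
  "deg_radius n f \<Omega> y =
     (INF x \<in> Euclidean_space n frontier_of \<Omega>. enorm n (\<lambda>i. f x i - y i))"

definition degree_sphere_map ::
  "nat \<Rightarrow> ((nat \<Rightarrow> real) \<Rightarrow> nat \<Rightarrow> real) \<Rightarrow> (nat \<Rightarrow> real) set \<Rightarrow> (nat \<Rightarrow> real)
     \<Rightarrow> (nat \<Rightarrow> real) \<Rightarrow> nat \<Rightarrow> real" where
  "degree_sphere_map n f \<Omega> y =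
     (\<lambda>p. if p \<noteq> north_pole n \<and> stereographic n p \<in> \<Omega>
          then ball_collapse n (\<lambda>i. (f (stereographic n p) i - y i) / deg_radius n f \<Omega> y)
          else north_pole n)"

definition Brouwer_deg ::
  "nat \<Rightarrow> ((nat \<Rightarrow> real) \<Rightarrow> nat \<Rightarrow> real) \<Rightarrow> (nat \<Rightarrow> real) set \<Rightarrow> (nat \<Rightarrow> real) \<Rightarrow> int" where
  "Brouwer_deg n f \<Omega> y = Brouwer_degree2 n (degree_sphere_map n f \<Omega> y)"

definition bounded_open :: "nat \<Rightarrow> (nat \<Rightarrow> real) set \<Rightarrow> bool" where
  "bounded_open n \<Omega> \<longleftrightarrow> openin (Euclidean_space n) \<Omega> \<and> (\<exists>B. \<forall>x\<in>\<Omega>. enorm n x \<le> B)"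

section \<open>The degree of a matrix\<close>

definition min_map :: "real mat \<Rightarrow> (nat \<Rightarrow> real) \<Rightarrow> nat \<Rightarrow> real" where
  "min_map A x = (\<lambda>i. if i < dim_row A then min (x i) ((A *\<^sub>v vec (dim_col A) x) $ i) else 0)"

text \<open>
  For an R0 matrix the degree of \<open>min_map A\<close> at \<open>0\<close> does not depend on the bounded open set
  around \<open>0\<close>; the common value is the degree of the matrix. No meaning is intended for other matrices.
\<close>

definition mat_degree :: "real mat \<Rightarrow> int" where
  "mat_degree A = (THE d. \<forall>\<Omega>. bounded_open (dim_row A) \<Omega> \<and> (\<lambda>i. 0) \<in> \<Omega> \<longrightarrow>
     Brouwer_deg (dim_row A) (min_map A) \<Omega> (\<lambda>i. 0) = d)"

section \<open>Properties of the degree that justify the definition\<close>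

text \<open>
  The sphere map is continuous under the standing assumptions on \<open>f\<close>, \<open>\<Omega>\<close> and \<open>y\<close>
  (\<open>continuous_degree_sphere_map\<close>), a nonzero degree forces a solution of \<open>f x = y\<close> in \<open>\<Omega>\<close>
  (\<open>Brouwer_deg_nonzero_imp_solution\<close>), and the identity has degree \<open>1\<close>
  (\<open>Brouwer_deg_id\<close>).
\<close>

lemma enorm_ge_0 [simp]: "0 \<le> enorm n x"
  by (simp add: enorm_def sum_nonneg)

lemma enorm_sq: "(enorm n x)\<^sup>2 = (\<Sum>i<n. (x i)\<^sup>2)"
  by (simp add: enorm_def sum_nonneg)

lemma enorm_divide: "enorm n (\<lambda>i. x i / r) = enorm n x / \<bar>r\<bar>"
  by (simp add: enorm_def power_divide real_sqrt_divide flip: sum_divide_distrib)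

lemma continuous_on_coord: "continuous_on S (\<lambda>x::nat\<Rightarrow>real. x i)"
  by (rule continuous_on_subset[OF continuous_on_product_coordinates]) simp

lemma continuous_on_enorm:
  assumes "continuous_on S g" shows "continuous_on S (\<lambda>x. enorm n (g x))"
  unfolding enorm_def 
  by (intro continuous_intros continuous_on_product_then_coordinatewise[OF assms])

lemma nsphere_top_of_set: 
  "nsphere n = top_of_set {x. (\<Sum>i<n. (x i)\<^sup>2) + (x n)\<^sup>2 = 1 \<and> (\<forall>i>n. x i = 0)}"
  unfolding nsphere euclidean_product_topology by (simp flip: lessThan_Suc_atMost)

lemma ball_collapse_eq:
  "ball_collapse n w = (\<lambda>i. if i < n then 2 * sqrt (max 0 (1 - (enorm n w)\<^sup>2)) * w i
     else if i = n then 2 * (min 1 ((enorm n w)\<^sup>2)) - 1 else 0)"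
proof (cases "enorm n w < 1")
  case True
  then have "(enorm n w)\<^sup>2 \<le> 1" by (simp add: power_le_one)
  with True show ?thesis by (auto simp: ball_collapse_def fun_eq_iff)
next
  case False
  then have "(enorm n w)\<^sup>2 \<ge> 1" by (simp add: one_le_power)
  with False show ?thesis by (auto simp: ball_collapse_def fun_eq_iff north_pole_def)
qed

lemma continuous_on_ball_collapse:
  assumes "continuous_on S g" shows "continuous_on S (\<lambda>x. ball_collapse n (g x))"
  unfolding ball_collapse_eq
proof (rule continuous_on_coordinatewise_then_product)
  fix i
  have 1: "continuous_on S (\<lambda>x. (enorm n (g x))\<^sup>2)"
    by (intro continuous_intros continuous_on_enorm assms)
  show "continuous_on S (\<lambda>x. if i < n then 2 * sqrt (max 0 (1 - (enorm n (g x))\<^sup>2)) * g x i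
     else if i = n then 2 * (min 1 ((enorm n (g x))\<^sup>2)) - 1 else 0)"
    by (cases "i < n"; cases "i = n"; simp)
      (intro continuous_intros 1 continuous_on_product_then_coordinatewise[OF assms])+
qed

lemma north_pole_in: "north_pole n \<in> topspace (nsphere n)"
  by (simp add: nsphere_top_of_set north_pole_def)

lemma ball_collapse_in: "ball_collapse n w \<in> topspace (nsphere n)"
proof (cases "enorm n w < 1")
  case True
  then have "(enorm n w)\<^sup>2 \<le> 1" by (simp add: power_le_one)
  then have "(\<Sum>i<n. (2 * sqrt (1 - (enorm n w)\<^sup>2) * w i)\<^sup>2) + (2 * (enorm n w)\<^sup>2 - 1)\<^sup>2 = 1"
    by (simp add: power_mult_distrib flip: sum_distrib_left enorm_sq)
       (simp add: algebra_simps power2_eq_square)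
  with True show ?thesis by (simp add: nsphere_top_of_set ball_collapse_def)
next
  case False
  then show ?thesis using north_pole_in by (simp add: ball_collapse_def)
qed

lemma sphere_height: 
  assumes "p \<in> topspace (nsphere n)" "p \<noteq> north_pole n" shows "p n < 1"
proof (rule ccontr)
  assume "\<not> p n < 1"
  then have "(p n)\<^sup>2 \<ge> 1" by simp
  moreover have "(\<Sum>i<n. (p i)\<^sup>2) \<ge> 0" by (simp add: sum_nonneg)
  moreover have s: "(\<Sum>i<n. (p i)\<^sup>2) + (p n)\<^sup>2 = 1" "\<forall>i>n. p i = 0" using assms by (auto simp: nsphere_top_of_set)
  ultimately have 1: "(\<Sum>i<n. (p i)\<^sup>2) = 0" and 2: "(p n)\<^sup>2 = 1" by linarith+
  from 1 have "\<forall>i<n. p i = 0" by (simp add: sum_nonneg_eq_0_iff)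
  moreover from 2 \<open>\<not> p n < 1\<close> have "p n = 1" by (auto simp: power2_eq_1_iff)
  ultimately have "p = north_pole n" using s(2) by (auto simp: north_pole_def fun_eq_iff) (metis linorder_neqE_nat)
  with assms show False by simp
qed

lemma enorm_stereographic:
  assumes "p \<in> topspace (nsphere n)" "p \<noteq> north_pole n"
  shows "(enorm n (stereographic n p))\<^sup>2 = (1 + p n) / (1 - p n)"
proof -
  have h: "p n < 1" by (rule sphere_height[OF assms])
  have "(\<Sum>i<n. (p i)\<^sup>2) = 1 - (p n)\<^sup>2" using assms by (auto simp: nsphere_top_of_set)
  also have "\<dots> = (1 + p n) * (1 - p n)" by (simp add: algebra_simps power2_eq_square)
  finally show ?thesis using h
    by (simp add: enorm_sq stereographic_def power_divide flip: sum_divide_distrib)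
       (simp add: power2_eq_square)
qed

lemma continuous_on_stereographic:
  "continuous_on {p. p n < 1} (stereographic n)"
  unfolding stereographic_def
proof (rule continuous_on_coordinatewise_then_product)
  fix i 
  have "continuous_on {p::nat\<Rightarrow>real. p n < 1} (\<lambda>x. x i / (1 - x n))"
    by (rule continuous_on_divide[OF continuous_on_coord continuous_on_diff[OF continuous_on_const continuous_on_coord]]) auto
  then show "continuous_on {p::nat\<Rightarrow>real. p n < 1} (\<lambda>x. if i < n then x i / (1 - x n) else 0)"
    by (cases "i < n") auto
qed

lemma Euclidean_space_top_of_set: "Euclidean_space n = top_of_set {x. \<forall>i\<ge>n. x i = 0}"
  by (simp add: Euclidean_space_def euclidean_product_topology)


lemma closed_Euclidean: "closed {x::nat\<Rightarrow>real. \<forall>i\<ge>n. x i = 0}"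
  using closedin_Euclidean_space[of n] by (simp add: topspace_Euclidean_space euclidean_product_topology)

lemma frontier_of_Euclidean:
  assumes "openin (Euclidean_space n) \<Omega>"
  shows "Euclidean_space n frontier_of \<Omega> = closure \<Omega> - \<Omega>" "closure \<Omega> \<subseteq> {x. \<forall>i\<ge>n. x i = 0}"
proof -
  have sub: "\<Omega> \<subseteq> {x. \<forall>i\<ge>n. x i = 0}" using openin_subset[OF assms] by (simp add: topspace_Euclidean_space)
  then show 1: "closure \<Omega> \<subseteq> {x. \<forall>i\<ge>n. x i = 0}" by (intro closure_minimal closed_Euclidean)
  have "Euclidean_space n closure_of \<Omega> = closure \<Omega>"
    using sub 1 unfolding Euclidean_space_top_of_set closure_of_subtopology 
    by (simp add: Int_absorb1 Int_absorb2)
  then show "Euclidean_space n frontier_of \<Omega> = closure \<Omega> - \<Omega>"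
    by (simp add: frontier_of_def interior_of_openin assms)
qed

lemma compact_closure_bounded_open:
  assumes "bounded_open n \<Omega>" shows "compact (closure \<Omega>)"
proof -
  obtain B where B: "\<And>x. x \<in> \<Omega> \<Longrightarrow> enorm n x \<le> B" and o: "openin (Euclidean_space n) \<Omega>"
    using assms by (auto simp: bounded_open_def)
  have sub: "\<Omega> \<subseteq> {x. \<forall>i\<ge>n. x i = 0}" using openin_subset[OF o] by (simp add: topspace_Euclidean_space)
  let ?K = "PiE UNIV (\<lambda>i::nat. if i < n then {-B..B} else {0::real})"
  have "compactin (product_topology (\<lambda>i. euclidean) UNIV) ?K"
    by (subst compactin_PiE) auto
  then have K: "compact ?K" by (simp add: euclidean_product_topology)
  have "\<Omega> \<subseteq> ?K"
  proof
    fix x assume x: "x \<in> \<Omega>"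
    have "\<bar>x i\<bar> \<le> B" if "i < n" for i
    proof -
      have "(x i)\<^sup>2 \<le> (\<Sum>i<n. (x i)\<^sup>2)" using that by (intro member_le_sum) auto
      then have "\<bar>x i\<bar> \<le> enorm n x" unfolding enorm_def by (simp add: real_le_rsqrt)
      with B[OF x] show ?thesis by simp
    qed
    with x sub show "x \<in> ?K" by (fastforce simp: abs_le_iff PiE_iff split: if_splits)
  qed
  moreover have "closed ?K" using K by (rule compact_imp_closed)
  ultimately have "closure \<Omega> \<subseteq> ?K" by (intro closure_minimal)
  then show ?thesis using K by (metis closed_closure compact_Int_closed inf.absorb_iff2 inf_commute)
qed

lemma deg_radius_pos_le:
  assumes "bounded_open n \<Omega>" "continuous_on (closure \<Omega>) f"
    "\<And>x. x \<in> closure \<Omega> - \<Omega> \<Longrightarrow> \<exists>i<n. f x i \<noteq> y i" "x \<in> closure \<Omega> - \<Omega>"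
  shows "0 < deg_radius n f \<Omega> y" "deg_radius n f \<Omega> y \<le> enorm n (\<lambda>i. f x i - y i)"
proof -
  let ?F = "closure \<Omega> - \<Omega>" and ?g = "\<lambda>x. enorm n (\<lambda>i. f x i - y i)"
  have o: "openin (Euclidean_space n) \<Omega>" using assms by (auto simp: bounded_open_def)
  note fr = frontier_of_Euclidean[OF o]
  obtain T where T: "open T" "\<Omega> = {x. \<forall>i\<ge>n. x i = 0} \<inter> T" 
    using o unfolding Euclidean_space_top_of_set openin_open by auto
  then have "?F = closure \<Omega> - T" using fr by auto
  then have "compact ?F" using T compact_closure_bounded_open[OF assms(1)] by (simp add: compact_diff)
  moreover have c: "continuous_on ?F ?g"
  proof -
    have "continuous_on ?F f" by (rule continuous_on_subset[OF assms(2)]) auto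
    then have "continuous_on ?F (\<lambda>p. f p i)" for i
      by (rule continuous_on_product_then_coordinatewise)
    then have "continuous_on ?F (\<lambda>p. f p i - y i)" for i
      by (intro continuous_on_diff continuous_on_const)
    then have "continuous_on ?F (\<lambda>p i. f p i - y i)"
      by (rule continuous_on_coordinatewise_then_product)
    then show ?thesis by (rule continuous_on_enorm)
  qed
  ultimately obtain z where z: "z \<in> ?F" "\<And>x. x \<in> ?F \<Longrightarrow> ?g z \<le> ?g x" 
    using continuous_attains_inf[of ?F ?g] assms(4) by auto
  have r: "deg_radius n f \<Omega> y = (INF x \<in> ?F. ?g x)" by (simp add: deg_radius_def fr)
  have "(INF x \<in> ?F. ?g x) = ?g z"
    by (rule cInf_eq_minimum) (use z in auto)
  moreover have "?g z > 0"
  proof -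
    obtain i where i: "i < n" "f z i \<noteq> y i" using assms(3) z by blast
    then have "0 < (f z i - y i)\<^sup>2" by simp
    also have "\<dots> \<le> (\<Sum>i<n. (f z i - y i)\<^sup>2)" using i by (intro member_le_sum) auto
    finally show ?thesis by (simp add: enorm_def)
  qed
  ultimately show "0 < deg_radius n f \<Omega> y" "deg_radius n f \<Omega> y \<le> ?g x" 
    using r z assms(4) by auto
qed

lemma continuous_degree_sphere_map:
  assumes bo: "bounded_open n \<Omega>" and cf: "continuous_on (closure \<Omega>) f"
    and ne: "\<And>x. x \<in> closure \<Omega> - \<Omega> \<Longrightarrow> \<exists>i<n. f x i \<noteq> y i"
  shows "continuous_map (nsphere n) (nsphere n) (degree_sphere_map n f \<Omega> y)"
proof -
  define S where "S = topspace (nsphere n)"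
  define r where "r = deg_radius n f \<Omega> y"
  define G where "G = (\<lambda>p. ball_collapse n (\<lambda>i. (f (stereographic n p) i - y i) / r))"
  define P where "P = (\<lambda>p. p \<noteq> north_pole n \<and> stereographic n p \<in> \<Omega>)"
  have S: "nsphere n = top_of_set S" unfolding S_def nsphere_top_of_set by simp
  have o: "openin (Euclidean_space n) \<Omega>" using bo by (auto simp: bounded_open_def)
  note fr = frontier_of_Euclidean[OF o]
  obtain T where T: "open T" "\<Omega> = {x. \<forall>i\<ge>n. x i = 0} \<inter> T" 
    using o unfolding Euclidean_space_top_of_set openin_open by auto
  obtain B where B: "\<And>x. x \<in> \<Omega> \<Longrightarrow> enorm n x \<le> B" using bo by (auto simp: bounded_open_def)
  have B': "enorm n x \<le> B" if "x \<in> closure \<Omega>" for x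
    using that B continuous_le_on_closure[of \<Omega> "enorm n" x B] continuous_on_enorm[of _ "\<lambda>x. x"] by auto
  define b where "b = (B\<^sup>2 - 1) / (B\<^sup>2 + 1)"
  have pos: "B\<^sup>2 + 1 > 0" by (simp add: add_nonneg_pos)
  have b1: "b < 1" using pos by (simp add: b_def pos_divide_less_eq)
  have height: "p n \<le> b" if "p \<in> S" "p \<noteq> north_pole n" "stereographic n p \<in> closure \<Omega>" for p
  proof -
    have h: "p n < 1" using that sphere_height by (simp add: S_def)
    have "(enorm n (stereographic n p))\<^sup>2 \<le> B\<^sup>2" using B'[OF that(3)] by (intro power_mono) auto
    then have "(1 + p n) / (1 - p n) \<le> B\<^sup>2" using enorm_stereographic that by (simp add: S_def)
    then have "1 + p n \<le> B\<^sup>2 * (1 - p n)" using h by (simp add: pos_divide_le_eq)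
    then have "p n * (B\<^sup>2 + 1) \<le> B\<^sup>2 - 1" by (simp add: algebra_simps)
    then show ?thesis using pos by (simp add: b_def pos_le_divide_eq)
  qed
  define C where "C = {p \<in> S. p n \<le> b \<and> stereographic n p \<in> closure \<Omega>}"
  define U where "U = {p \<in> S. P p}"
  have np: "north_pole n n = 1" by (simp add: north_pole_def)
  have UC: "U \<subseteq> C" using height closure_subset by (fastforce simp: U_def C_def P_def)
  have clS: "closed S" unfolding S_def nsphere_top_of_set
  proof -
    have "{x::nat\<Rightarrow>real. (\<Sum>i<n. (x i)\<^sup>2) + (x n)\<^sup>2 = 1 \<and> (\<forall>i>n. x i = 0)} =
      {x. (\<Sum>i<n. (x i)\<^sup>2) + (x n)\<^sup>2 = 1} \<inter> {x. \<forall>i\<ge>Suc n. x i = 0}" by (auto simp: Suc_le_eq)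
    moreover have "closed {x::nat\<Rightarrow>real. (\<Sum>i<n. (x i)\<^sup>2) + (x n)\<^sup>2 = 1}"
      by (intro closed_Collect_eq continuous_intros continuous_on_coord)
    ultimately show "closed (topspace (top_of_set {x::nat\<Rightarrow>real. (\<Sum>i<n. (x i)\<^sup>2) + (x n)\<^sup>2 = 1 \<and> (\<forall>i>n. x i = 0)}))" 
      using closed_Euclidean[of "Suc n"] by auto
  qed
  have cb: "closed {p::nat\<Rightarrow>real. p n \<le> b}"
    by (intro closed_Collect_le continuous_intros continuous_on_coord)
  have cst: "continuous_on {p. p n \<le> b} (stereographic n)"
    by (rule continuous_on_subset[OF continuous_on_stereographic]) (use b1 in auto)
  have "closed ({p. p n \<le> b} \<inter> stereographic n -` closure \<Omega>)"
    by (rule continuous_closed_preimage[OF cst cb closed_closure])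
  then have "closed (S \<inter> ({p. p n \<le> b} \<inter> stereographic n -` closure \<Omega>))" using clS by blast
  also have "S \<inter> ({p. p n \<le> b} \<inter> stereographic n -` closure \<Omega>) = C" by (auto simp: C_def)
  finally have clC: "closed C" .
  have PT: "P p \<longleftrightarrow> p n < 1 \<and> stereographic n p \<in> T" if "p \<in> S" for p
    using that sphere_height[of p n] T np by (auto simp: P_def S_def stereographic_def)
  have o1: "open {p::nat\<Rightarrow>real. p n < 1}" by (intro open_Collect_less continuous_intros continuous_on_coord)
  have "open ({p. p n < 1} \<inter> stereographic n -` T)"
    by (rule continuous_open_preimage[OF continuous_on_stereographic o1 T(1)])
  then have "closed (S - ({p. p n < 1} \<inter> stereographic n -` T))" using clS by blast
  also have "S - ({p. p n < 1} \<inter> stereographic n -` T) = S - U" using PT by (auto simp: U_def)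
  finally have clU: "closed (S - U)" .
  have cG: "continuous_on C G"
  proof -
    have "continuous_on C (stereographic n)" by (rule continuous_on_subset[OF cst]) (auto simp: C_def)
    moreover have "stereographic n ` C \<subseteq> closure \<Omega>" by (auto simp: C_def)
    ultimately have "continuous_on C (\<lambda>p. f (stereographic n p))"
      by (rule continuous_on_compose2[OF cf])
    then have "continuous_on C (\<lambda>p. f (stereographic n p) i)" for i
      by (rule continuous_on_product_then_coordinatewise)
    then have "continuous_on C (\<lambda>p. (f (stereographic n p) i - y i) * inverse r)" for i
      by (intro continuous_on_mult continuous_on_diff continuous_on_const)
    then have "continuous_on C (\<lambda>p i. (f (stereographic n p) i - y i) * inverse r)"
      by (rule continuous_on_coordinatewise_then_product)
    then show ?thesis unfolding G_def divide_inverse by (rule continuous_on_ball_collapse)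
  qed
  have "continuous_on (C \<union> (S - U)) (\<lambda>p. if P p then G p else north_pole n)"
  proof (rule continuous_on_cases[OF clC clU cG continuous_on_const])
    show "\<forall>p. p \<in> C \<and> \<not> P p \<or> p \<in> S - U \<and> P p \<longrightarrow> G p = north_pole n"
    proof (intro allI impI)
      fix p assume "p \<in> C \<and> \<not> P p \<or> p \<in> S - U \<and> P p"
      then have p: "p \<in> C" "\<not> P p" by (auto simp: U_def)
      then have "p \<noteq> north_pole n" using np b1 by (auto simp: C_def)
      then have x: "stereographic n p \<in> closure \<Omega> - \<Omega>" using p by (auto simp: C_def P_def)
      note * = deg_radius_pos_le[OF bo cf ne x, folded r_def]
      then have "enorm n (\<lambda>i. (f (stereographic n p) i - y i) / r) \<ge> 1"
        by (simp add: enorm_divide)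
      then show "G p = north_pole n" by (simp add: G_def ball_collapse_def)
    qed
  qed
  moreover have "C \<union> (S - U) = S" using UC by (auto simp: C_def U_def)
  ultimately have "continuous_on S (degree_sphere_map n f \<Omega> y)" 
    unfolding degree_sphere_map_def r_def G_def P_def by simp
  moreover have "degree_sphere_map n f \<Omega> y \<in> S \<rightarrow> S"
    using ball_collapse_in north_pole_in by (auto simp: degree_sphere_map_def S_def)
  ultimately show ?thesis unfolding S by simp
qed

lemma nonempty_frontier:
  assumes bo: "bounded_open n \<Omega>" and x: "x \<in> \<Omega>" and n: "n > 0"
  shows "closure \<Omega> - \<Omega> \<noteq> {}"
proof
  assume e: "closure \<Omega> - \<Omega> = {}"
  have o: "openin (Euclidean_space n) \<Omega>" using bo by (auto simp: bounded_open_def)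
  have "closed \<Omega>" using e by (metis Diff_eq_empty_iff closure_subset closure_closed closed_closure subset_antisym)
  then have "closedin (Euclidean_space n) \<Omega>"
    using openin_subset[OF o] by (simp add: closedin_Euclidean_space_iff)
  then have U: "\<Omega> = topspace (Euclidean_space n)"
    using o x connected_Euclidean_space[of n] unfolding connected_space_clopen_in by blast
  obtain B where B: "\<And>x. x \<in> \<Omega> \<Longrightarrow> enorm n x \<le> B" using bo by (auto simp: bounded_open_def)
  let ?x = "\<lambda>i. if i = 0 then \<bar>B\<bar> + 1 else 0 :: real"
  have "enorm n ?x \<le> B" using n by (intro B) (auto simp: U topspace_Euclidean_space)
  moreover have "(\<Sum>i<n. (?x i)\<^sup>2) = (\<bar>B\<bar> + 1)\<^sup>2" using n by (simp add: if_distrib[where f="\<lambda>x. x\<^sup>2"] cong: if_cong)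
  ultimately show False by (simp add: enorm_def)
qed

lemma Brouwer_deg_nonzero_imp_solution:
  assumes bo: "bounded_open n \<Omega>" and cf: "continuous_on (closure \<Omega>) f"
    and ne: "\<And>x. x \<in> closure \<Omega> - \<Omega> \<Longrightarrow> \<exists>i<n. f x i \<noteq> y i"
    and deg: "Brouwer_deg n f \<Omega> y \<noteq> 0"
  shows "\<exists>x\<in>\<Omega>. \<forall>i<n. f x i = y i"
proof (rule ccontr)
  assume no: "\<not> ?thesis"
  let ?s = "\<lambda>i. if i = n then -1 else 0 :: real"
  have s: "?s \<in> topspace (nsphere n)" by (simp add: nsphere_top_of_set)
  have "degree_sphere_map n f \<Omega> y p \<noteq> ?s" for p
  proof
    assume eq: "degree_sphere_map n f \<Omega> y p = ?s"
    have "north_pole n \<noteq> ?s" by (auto simp: north_pole_def fun_eq_iff)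
    with eq have P: "stereographic n p \<in> \<Omega>" 
      and "ball_collapse n (\<lambda>i. (f (stereographic n p) i - y i) / deg_radius n f \<Omega> y) = ?s" 
      by (auto simp: degree_sphere_map_def split: if_splits)
    then have "ball_collapse n (\<lambda>i. (f (stereographic n p) i - y i) / deg_radius n f \<Omega> y) n = -1" by simp
    then have e: "enorm n (\<lambda>i. f (stereographic n p) i - y i) / \<bar>deg_radius n f \<Omega> y\<bar> = 0"
      by (auto simp: ball_collapse_eq enorm_divide min_def split: if_splits)
    obtain i where i: "i < n" "f (stereographic n p) i \<noteq> y i" using no P by auto
    have "\<exists>x. x \<in> closure \<Omega> - \<Omega>" using nonempty_frontier[OF bo P] i by auto
    then have "deg_radius n f \<Omega> y > 0" using deg_radius_pos_le[OF bo cf ne] by auto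
    with e have "(enorm n (\<lambda>i. f (stereographic n p) i - y i))\<^sup>2 = 0" by simp
    then have "(\<Sum>i<n. (f (stereographic n p) i - y i)\<^sup>2) = 0" unfolding enorm_sq .
    then show False using i by (auto simp: sum_nonneg_eq_0_iff)
  qed
  note nots = this
  have "degree_sphere_map n f \<Omega> y ` topspace (nsphere n) \<noteq> topspace (nsphere n)"
  proof
    assume "degree_sphere_map n f \<Omega> y ` topspace (nsphere n) = topspace (nsphere n)"
    with s have "?s \<in> degree_sphere_map n f \<Omega> y ` topspace (nsphere n)" by (simp only:)
    then obtain p where "?s = degree_sphere_map n f \<Omega> y p" by (rule imageE)
    with nots[of p] show False by (rule notE[OF _ sym])
  qed
  from Brouwer_degree2_nonsurjective[OF continuous_degree_sphere_map[OF bo cf ne] this] deg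
  show False by (simp only: Brouwer_deg_def)
qed


lemma homotopic_non_antipodal:
  assumes f: "continuous_map (nsphere n) (nsphere n) f" and g: "continuous_map (nsphere n) (nsphere n) g"
    and ap: "\<And>x. x \<in> topspace (nsphere n) \<Longrightarrow> f x \<noteq> (\<lambda>i. - g x i)"
  shows "homotopic_with (\<lambda>x. True) (nsphere n) (nsphere n) f g"
proof -
  define S where "S = topspace (nsphere n)"
  define N where "N x = (\<Sum>i<Suc n. (x i)\<^sup>2)" for x :: "nat \<Rightarrow> real"
  have Sdef: "S = {x. N x = 1 \<and> (\<forall>i>n. x i = 0)}" by (simp add: S_def nsphere_top_of_set N_def)
  have S: "nsphere n = top_of_set S" by (simp add: nsphere_top_of_set Sdef N_def)
  define h where "h = (\<lambda>(t::real, x) i. (1 - t) * f x i + t * g x i)"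
  define k where "k = (\<lambda>z i. h z i / sqrt (N (h z)))"
  have cf: "continuous_on S f" and cg: "continuous_on S g" 
    and fS: "f x \<in> S" and gS: "g x \<in> S" if "x \<in> S" for x
    using f g that unfolding S by auto
  have cf: "continuous_on S f" and cg: "continuous_on S g" using f g unfolding S by auto
  have nz: "N (h (t, x)) > 0" if "t \<in> {0..1}" "x \<in> S" for t x
  proof (rule ccontr)
    assume "\<not> N (h (t, x)) > 0"
    moreover have "N (h (t, x)) \<ge> 0" by (simp add: N_def sum_nonneg del: sum.lessThan_Suc)
    ultimately have "N (h (t, x)) = 0" by simp
    then have z: "(1 - t) * f x i = - (t * g x i)" if "i < Suc n" for i
      using that by (simp add: N_def sum_nonneg_eq_0_iff h_def add_eq_0_iff del: sum.lessThan_Suc)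
    have "(1 - t)\<^sup>2 = (\<Sum>i<Suc n. ((1 - t) * f x i)\<^sup>2)" 
      using fS[OF that(2)] by (simp add: Sdef N_def power_mult_distrib del: sum.lessThan_Suc flip: sum_distrib_left)
    also have "\<dots> = (\<Sum>i<Suc n. (t * g x i)\<^sup>2)" using z by (intro sum.cong) auto
    also have "\<dots> = t\<^sup>2"
      using gS[OF that(2)] by (simp add: Sdef N_def power_mult_distrib del: sum.lessThan_Suc flip: sum_distrib_left)
    finally have "1 - t = t" using that by (simp add: power2_eq_iff)
    then have t: "t = 1/2" by simp
    have "f x = (\<lambda>i. - g x i)"
    proof
      fix i show "f x i = - g x i"
        using z[of i] fS[OF that(2)] gS[OF that(2)] by (cases "i < Suc n") (auto simp: t Sdef)
    qed
    with ap that show False by (auto simp: S_def)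
  qed
  have "continuous_on ({0..1::real} \<times> S) (\<lambda>z. f (snd z))"
    by (rule continuous_on_compose2[OF cf continuous_on_snd[OF continuous_on_id]]) auto
  then have cf1: "continuous_on ({0..1::real} \<times> S) (\<lambda>z. f (snd z) i)" for i
    by (rule continuous_on_product_then_coordinatewise)
  have "continuous_on ({0..1::real} \<times> S) (\<lambda>z. g (snd z))"
    by (rule continuous_on_compose2[OF cg continuous_on_snd[OF continuous_on_id]]) auto
  then have cg1: "continuous_on ({0..1::real} \<times> S) (\<lambda>z. g (snd z) i)" for i
    by (rule continuous_on_product_then_coordinatewise)
  have ch: "continuous_on ({0..1} \<times> S) (\<lambda>z. h z i)" for i
    unfolding h_def case_prod_unfold
    by (intro continuous_on_add continuous_on_mult continuous_on_diff continuous_on_const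
       continuous_on_fst continuous_on_id cf1 cg1)
  have cN: "continuous_on ({0..1} \<times> S) (\<lambda>z. sqrt (N (h z)))" 
    unfolding N_def by (intro continuous_on_real_sqrt continuous_on_sum continuous_on_power ch)
  have "continuous_on ({0..1} \<times> S) (\<lambda>z. h z i / sqrt (N (h z)))" for i
    by (rule continuous_on_divide[OF ch cN]) (use nz in force)
  then have "continuous_on ({0..1} \<times> S) k" unfolding k_def
    by (rule continuous_on_coordinatewise_then_product)
  moreover have "k z \<in> S" if z: "z \<in> {0..1} \<times> S" for z
  proof -
    obtain t x where tx: "z = (t, x)" "t \<in> {0..1}" "x \<in> S" using z by auto
    have "N (k z) = N (h z) / (sqrt (N (h z)))\<^sup>2"
      by (simp add: k_def N_def power_divide del: sum.lessThan_Suc real_sqrt_pow2_iff flip: sum_divide_distrib)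
    then have "N (k z) = 1" using nz tx by force
    moreover have "k z i = 0" if "i > n" for i
      using fS gS tx that by (auto simp: k_def h_def Sdef)
    ultimately show ?thesis by (simp add: Sdef)
  qed
  moreover have "k (0, x) = f x" "k (1, x) = g x" if "x \<in> S" for x
    using fS[OF that] gS[OF that] by (auto simp: k_def h_def Sdef)
  ultimately show ?thesis
    unfolding S by (auto simp: homotopic_with intro!: exI[of _ k])
qed

lemma Brouwer_deg_id:
  assumes bo: "bounded_open n \<Omega>" and 0: "(\<lambda>i. 0) \<in> \<Omega>"
  shows "Brouwer_deg n id \<Omega> (\<lambda>i. 0) = 1"
proof -
  let ?F = "degree_sphere_map n id \<Omega> (\<lambda>i. 0)" and ?r = "deg_radius n id \<Omega> (\<lambda>i. 0)"
  have o: "openin (Euclidean_space n) \<Omega>" using bo by (auto simp: bounded_open_def)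
  have ne: "\<exists>i<n. id x i \<noteq> 0" if "x \<in> closure \<Omega> - \<Omega>" for x
  proof (rule ccontr)
    assume "\<not> ?thesis"
    then have "x i = 0" for i using frontier_of_Euclidean(2)[OF o] that by (cases "i < n") auto
    then have "x = (\<lambda>i. 0)" by auto
    with 0 that show False by simp
  qed
  have c: "continuous_map (nsphere n) (nsphere n) ?F"
    by (rule continuous_degree_sphere_map[OF bo _ ne]) (auto simp: continuous_on_id)
  have "homotopic_with (\<lambda>x. True) (nsphere n) (nsphere n) ?F id"
  proof (rule homotopic_non_antipodal[OF c])
    fix p assume p: "p \<in> topspace (nsphere n)"
    show "?F p \<noteq> (\<lambda>i. - id p i)"
    proof
      assume "?F p = (\<lambda>i. - id p i)"
      then have eq: "?F p i = - p i" for i by (simp add: fun_eq_iff)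
      show False
      proof (cases "p \<noteq> north_pole n \<and> stereographic n p \<in> \<Omega>")
        case False
        then have "north_pole n i = - p i" for i using eq[of i] by (auto simp: degree_sphere_map_def)
        then have pp: "p = (\<lambda>i. if i = n then -1 else 0)" 
          by (auto simp: north_pole_def fun_eq_iff split: if_splits) (metis minus_equation_iff neg_0_equal_iff_equal)+
        then have "stereographic n p = (\<lambda>i. 0)" "p \<noteq> north_pole n" 
          by (auto simp: stereographic_def north_pole_def fun_eq_iff)
        with False 0 show False by simp
      next
        case True
        define w where "w = (\<lambda>i. stereographic n p i / ?r)"
        have b: "ball_collapse n w i = - p i" for i
          using eq[of i] True by (simp add: degree_sphere_map_def w_def)
        have h: "p n < 1" using True p sphere_height by auto
        have z: "p i = 0" if i: "i < n" for i
        proof -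
          obtain x where x: "x \<in> closure \<Omega> - \<Omega>" using nonempty_frontier[OF bo 0] i by auto
          have "?r > 0" 
            by (rule deg_radius_pos_le(1)[OF bo _ ne x]) (auto simp: continuous_on_id)
          then have w: "w i = c * p i" if "c = 1 / ((1 - p n) * ?r)" for c using i that 
            by (simp add: w_def stereographic_def)
          define c where "c = 2 * sqrt (max 0 (1 - (enorm n w)\<^sup>2)) * (1 / ((1 - p n) * ?r))"
          have "c \<ge> 0" using \<open>?r > 0\<close> h by (simp add: c_def)
          moreover have "c * p i = - p i" using b[of i] i w[OF refl] by (simp add: ball_collapse_eq c_def)
          then have "(c + 1) * p i = 0" by (simp add: algebra_simps)
          ultimately show ?thesis by auto
        qed
        have "p n * p n = 1" using p z by (simp add: nsphere_top_of_set power2_eq_square)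
        then have "p n = -1" using h by (auto simp: square_eq_1_iff)
        moreover have "w = (\<lambda>i. 0)" using z by (auto simp: w_def stereographic_def)
        then have "ball_collapse n w n = -1" by (simp add: ball_collapse_eq enorm_def)
        ultimately show False using b[of n] by simp
      qed
    qed
  qed auto
  from Brouwer_degree2_homotopic[OF this] show ?thesis by (simp only: Brouwer_deg_def Brouwer_degree2_id)
qed

lemma type_IV_bdsw_count_bounds:
  assumes "type_IV_bdsw A" "n = dim_row A"
  shows "1 \<le> card {i. i < n \<and> A $$ (i, i) < 0}" "card {i. i < n \<and> A $$ (i, i) < 0} < n"
proof -
  let ?K = "{i. i < n \<and> A $$ (i, i) < 0}"
  obtain i j where ij: "i < n" "A $$ (i, i) > 0" "j < n" "A $$ (j, j) < 0"
    using assms by (auto simp: type_IV_bdsw_def)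
  have "j \<in> ?K" using ij by simp
  moreover have fin: "finite ?K" by simp
  ultimately have "card ?K \<noteq> 0" by (auto simp only: card_0_eq)
  then show "1 \<le> card ?K" by linarith
  have "?K \<subseteq> {..<n} - {i}" using ij by auto
  then have "card ?K \<le> card ({..<n} - {i})" by (intro card_mono) auto
  also have "\<dots> < n" using ij by simp
  finally show "card ?K < n" .
qed

end

theory Submission
  imports Defs
begin

text \<open>
  Write row \<open>i\<close> of \<open>A x\<close> as \<open>\<sigma>\<^sub>i (\<alpha>\<^sub>i x\<^sub>i - \<beta>\<^sub>i x\<^sub>i\<^sub>+\<^sub>1)\<close> with indices modulo \<open>n\<close>, positive
  \<open>\<alpha>\<^sub>i\<close>, \<open>\<beta>\<^sub>i\<close> and \<open>\<sigma>\<^sub>i\<close> the sign of the diagonal entry. Then \<open>(-1)\<^sup>k\<^sup>+\<^sup>1 det A\<close> is the difference of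
  the products of the \<open>\<beta>\<^sub>i\<close> and of the \<open>\<alpha>\<^sub>i\<close>.

  If it is positive, then going once around the cycle shows that
  \<open>x \<mapsto> min x (A x)\<close> never points opposite to \<open>x \<mapsto> (- \<sigma>\<^sub>i x\<^sub>i\<^sub>+\<^sub>1)\<^sub>i\<close>. The two induced sphere maps are
  therefore homotopic, and the second is a homeomorphism, so the degree is \<open>1\<close> or \<open>-1\<close>. The
  same argument applies to \<open>u \<mapsto> u\<^sup>- - A u\<^sup>+\<close>. This map is thus surjective, and a preimage \<open>u\<close> of \<open>q\<close>
  yields the solution \<open>u\<^sup>+\<close> of the complementarity problem for \<open>q\<close>.

  If it is not positive, then for \<open>z\<close> equal to \<open>1\<close> on the rows with negative diagonal entry and to
  \<open>0\<close> on the others, neither \<open>min x (A x) = z\<close> nor the complementarity problem for \<open>- z\<close> is solvable.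
  The first of these makes the sphere map nonsurjective, so the degree, when defined, is \<open>0\<close>.
\<close>

section \<open>The cyclic shift of indices modulo n\<close>

lemma cyclic_induct:
  assumes "i < n" "P i" and step: "\<And>i. i < n \<Longrightarrow> P i \<Longrightarrow> P (Suc i mod n)" and "j < n"
  shows "P j"
proof -
  have *: "P ((i + k) mod n)" for k
  proof (induction k)
    case 0
    with assms show ?case by simp
  next
    case (Suc k)
    from step[OF _ Suc] assms(1) show ?case by (simp add: mod_Suc_eq)
  qed
  \<comment> \<open>From i, \<open>n - i\<close> steps lead to index 0 and j further steps lead to
    j.\<close>
  have "(i + (n - i + j)) mod n = j" using assms(1,4) by simp
  with *[of "n - i + j"] show ?thesis by simp
qed

lemma bij_betw_Suc_mod: "0 < n \<Longrightarrow> bij_betw (\<lambda>i. Suc i mod n) {..<n} {..<n}"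
proof -
  assume n: "0 < n"
  have "inj_on (\<lambda>i. Suc i mod n) {..<n}"
    by (rule inj_onI) (auto simp: mod_Suc split: if_splits)
  moreover have "(\<lambda>i. Suc i mod n) ` {..<n} \<subseteq> {..<n}" using n by auto
  ultimately show ?thesis by (simp add: bij_betw_def endo_inj_surj)
qed

lemma prod_Suc_mod:
  fixes x :: "nat \<Rightarrow> 'a::comm_monoid_mult"
  shows "0 < n \<Longrightarrow> (\<Prod>i<n. x (Suc i mod n)) = (\<Prod>i<n. x i)"
  by (rule prod.reindex_bij_betw[OF bij_betw_Suc_mod])

section \<open>Inequalities around a signed cycle\<close>

locale signed_cycle =
  fixes n :: nat and \<alpha> \<beta> \<sigma> :: "nat \<Rightarrow> real"
  assumes n_pos: "0 < n"
    and \<alpha>_pos: "\<And>i. i < n \<Longrightarrow> 0 < \<alpha> i"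
    and \<beta>_pos: "\<And>i. i < n \<Longrightarrow> 0 < \<beta> i"
    and sign: "\<And>i. i < n \<Longrightarrow> \<sigma> i = 1 \<or> \<sigma> i = -1"
    and negative_row: "\<exists>m<n. \<sigma> m = -1"
begin

abbreviation nx :: "nat \<Rightarrow> nat" where "nx i \<equiv> Suc i mod n"

definition signed_row :: "(nat \<Rightarrow> real) \<Rightarrow> nat \<Rightarrow> real" where
  "signed_row x i = \<sigma> i * (\<alpha> i * x i - \<beta> i * x (nx i))"

lemma nx_less: "nx i < n" using n_pos by simp

text \<open>Multiply the inequalities over the cycle: the shift permutes the indices, so the
  positive product of the \<open>x i\<close> occurs on both sides and cancels.\<close>

lemma prod_le_around:
  assumes "\<And>i. i < n \<Longrightarrow> 0 < x i" "\<And>i. i < n \<Longrightarrow> \<beta> i * x (nx i) \<le> \<alpha> i * x i"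
  shows "(\<Prod>i<n. \<beta> i) \<le> (\<Prod>i<n. \<alpha> i)"
proof -
  have "(\<Prod>i<n. \<beta> i * x (nx i)) \<le> (\<Prod>i<n. \<alpha> i * x i)"
    using assms nx_less \<beta>_pos by (intro prod_mono) (simp add: less_imp_le)
  then have "(\<Prod>i<n. \<beta> i) * (\<Prod>i<n. x i) \<le> (\<Prod>i<n. \<alpha> i) * (\<Prod>i<n. x i)"
    by (simp add: prod.distrib prod_Suc_mod n_pos)
  moreover have "0 < (\<Prod>i<n. x i)" using assms by (intro prod_pos) auto
  ultimately show ?thesis by simp
qed

lemma prod_less_around:
  assumes "\<And>i. i < n \<Longrightarrow> 0 < x i" "\<And>i. i < n \<Longrightarrow> \<alpha> i * x i \<le> \<beta> i * x (nx i)"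
    and "m < n" "\<alpha> m * x m < \<beta> m * x (nx m)"
  shows "(\<Prod>i<n. \<alpha> i) < (\<Prod>i<n. \<beta> i)"
proof -
  have "(\<Prod>i<n. \<alpha> i * x i) < (\<Prod>i<n. \<beta> i * x (nx i))"
    using assms nx_less \<alpha>_pos \<beta>_pos by (intro prod_mono_strict[of m]) (simp_all add: less_imp_le)
  then have "(\<Prod>i<n. \<alpha> i) * (\<Prod>i<n. x i) < (\<Prod>i<n. \<beta> i) * (\<Prod>i<n. x i)"
    by (simp add: prod.distrib prod_Suc_mod n_pos)
  moreover have "0 < (\<Prod>i<n. x i)" using assms by (intro prod_pos) auto
  ultimately show ?thesis by simp
qed

text \<open>A positive entry would spread through \<open>step\<close> to the whole cycle, and
  \<open>prod_le_around\<close> would then contradict the order of the products.\<close>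

lemma some_nonpos:
  assumes "(\<Prod>i<n. \<alpha> i) < (\<Prod>i<n. \<beta> i)" "j < n"
    and step: "\<And>i. i < n \<Longrightarrow> 0 < x i \<Longrightarrow> 0 < x (nx i) \<and> \<beta> i * x (nx i) \<le> \<alpha> i * x i"
  shows "x j \<le> 0"
proof (rule ccontr)
  assume "\<not> x j \<le> 0"
  then have "0 < x i" if "i < n" for i
    using cyclic_induct[of j n "\<lambda>i. 0 < x i"] assms that by simp
  with prod_le_around[of x] step assms(1) show False by fastforce
qed

text \<open>Where \<open>x i\<close> is positive its row vanishes, which makes the next entry
  positive with equality in \<open>step\<close>; hence no entry is positive. This is the source of
  the R0 property.\<close>

lemma min_row_zero:
  assumes P: "(\<Prod>i<n. \<alpha> i) < (\<Prod>i<n. \<beta> i)"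
    and eq: "\<And>i. i < n \<Longrightarrow> min (x i) (signed_row x i) = 0" and "j < n"
  shows "x j = 0"
proof -
  have "x j \<le> 0"
  proof (rule some_nonpos[OF P \<open>j < n\<close>])
    fix i assume i: "i < n" "0 < x i"
    have "signed_row x i = 0" using eq[OF i(1)] i(2) by (auto simp: min_def split: if_splits)
    then have "\<alpha> i * x i = \<beta> i * x (nx i)" using sign[OF i(1)] by (auto simp: signed_row_def)
    moreover have "0 < \<alpha> i * x i" using \<alpha>_pos i by simp
    ultimately show "0 < x (nx i) \<and> \<beta> i * x (nx i) \<le> \<alpha> i * x i"
      using \<beta>_pos[OF i(1)] by (simp add: zero_less_mult_iff)
  qed
  with eq[OF \<open>j < n\<close>] show ?thesis by (auto simp: min_def split: if_splits)
qed

text \<open>The signs \<open>- \<sigma> i\<close> of the shift are chosen so that, for c > 0, a row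
  of sign -1 forces its successor to be positive, while a positive entry in any row forces a
  positive successor with \<open>\<beta> i * x (nx i) \<le> \<alpha> i * x i\<close>. By
  \<open>some_nonpos\<close> the latter excludes positive entries, contradicting the former.\<close>

lemma min_row_not_opposite:
  assumes P: "(\<Prod>i<n. \<alpha> i) < (\<Prod>i<n. \<beta> i)" and "0 \<le> c"
    and eq: "\<And>i. i < n \<Longrightarrow> min (x i) (signed_row x i) = - c * (- \<sigma> i * x (nx i))" and j: "j < n"
  shows "x j = 0"
proof (rule ccontr)
  assume nz: "x j \<noteq> 0"
  have c: "c > 0" using min_row_zero[OF P _ j, of x] eq nz \<open>0 \<le> c\<close> by (cases "c = 0") auto
  have prods: "0 < \<alpha> i * x i \<longleftrightarrow> 0 < x i" "\<alpha> i * x i < 0 \<longleftrightarrow> x i < 0"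
     "0 < \<beta> i * x (nx i) \<longleftrightarrow> 0 < x (nx i)" "\<beta> i * x (nx i) < 0 \<longleftrightarrow> x (nx i) < 0"
     "0 < c * x (nx i) \<longleftrightarrow> 0 < x (nx i)" "c * x (nx i) < 0 \<longleftrightarrow> x (nx i) < 0" if "i < n" for i
    using \<alpha>_pos[OF that] \<beta>_pos[OF that] c by (auto simp: zero_less_mult_iff mult_less_0_iff)
  have e: "min (x i) (\<alpha> i * x i - \<beta> i * x (nx i)) = c * x (nx i) \<and> \<sigma> i = 1 \<or>
     min (x i) (\<beta> i * x (nx i) - \<alpha> i * x i) = - (c * x (nx i)) \<and> \<sigma> i = -1" if "i < n" for i
    using eq[OF that] sign[OF that] by (auto simp: signed_row_def)
  \<comment> \<open>Zeros travel forward around the cycle, so a single nonzero entry excludes all of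
    them.\<close>
  have "x (nx i) = 0" if "i < n" "x i = 0" for i
    using e[OF that(1)] prods[OF that(1)] that(2) by (smt (verit))
  then have nz': "x i \<noteq> 0" if "i < n" for i
    using cyclic_induct[of i n "\<lambda>i. x i = 0" j] that nz j by auto
  have m: "0 < x (nx i)" if "i < n" "\<sigma> i = -1" for i
    using e[OF that(1)] prods[OF that(1)] that(2) nz'[OF that(1)] nz'[OF nx_less[of i]] by (smt (verit))
  obtain m where "m < n" "\<sigma> m = -1" using negative_row by auto
  with m have "0 < x (nx m)" by simp
  moreover have "x (nx m) \<le> 0"
  proof (rule some_nonpos[OF P nx_less])
    fix i assume i: "i < n" "0 < x i"
    show "0 < x (nx i) \<and> \<beta> i * x (nx i) \<le> \<alpha> i * x i"
      using e[OF i(1)] prods[OF i(1)] i(2) nz'[OF nx_less[of i]] by (smt (verit))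
  qed
  ultimately show False by simp
qed

text \<open>The positive and negative parts of \<open>u\<close> are nonnegative with disjoint
  supports, so complementarity is built into the equation \<open>comp_map u i = q i\<close>.\<close>

definition comp_map :: "(nat \<Rightarrow> real) \<Rightarrow> nat \<Rightarrow> real" where
  "comp_map u i = (if i < n then max 0 (- u i) - signed_row (\<lambda>j. max 0 (u j)) i else 0)"

text \<open>The scheme is that of \<open>min_row_not_opposite\<close>, now with the signs
  \<open>\<sigma> i\<close>, because the row enters \<open>comp_map\<close> with a minus
  sign.\<close>

lemma comp_map_not_opposite:
  assumes P: "(\<Prod>i<n. \<alpha> i) < (\<Prod>i<n. \<beta> i)" and "0 \<le> c"
    and eq: "\<And>i. i < n \<Longrightarrow> comp_map u i = - c * (\<sigma> i * u (nx i))" and j: "j < n"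
  shows "u j = 0"
proof (rule ccontr)
  assume nz: "u j \<noteq> 0"
  define a b where "a i = \<alpha> i * max 0 (u i)" and "b i = \<beta> i * max 0 (u (nx i))" for i
  have a: "0 < u i \<Longrightarrow> 0 < a i \<and> a i = \<alpha> i * u i" "u i \<le> 0 \<Longrightarrow> a i = 0"
     and b: "0 < u (nx i) \<Longrightarrow> 0 < b i \<and> b i = \<beta> i * u (nx i)" "u (nx i) \<le> 0 \<Longrightarrow> b i = 0" if "i < n" for i
    using \<alpha>_pos[OF that] \<beta>_pos[OF that] by (auto simp: a_def b_def)
  have e: "max 0 (- u i) - (a i - b i) = - (c * u (nx i)) \<and> \<sigma> i = 1 \<or>
     max 0 (- u i) - (b i - a i) = c * u (nx i) \<and> \<sigma> i = -1" if "i < n" for i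
    using eq[OF that] sign[OF that] that by (auto simp: comp_map_def signed_row_def a_def b_def)
  show False
  proof (cases "c = 0")
    case True
    \<comment> \<open>A positive entry gives \<open>a i = b i\<close>, so \<open>some_nonpos\<close>
      excludes positive entries. Then \<open>a\<close> and \<open>b\<close> vanish at j and the
      equation leaves \<open>max 0 (- u j) = 0\<close>.\<close>
    have "u i \<le> 0" if "i < n" for i
    proof (rule some_nonpos[OF P that])
      fix i assume i: "i < n" "0 < u i"
      have "a i = b i" using e[OF i(1)] i(2) True by auto
      then show "0 < u (nx i) \<and> \<beta> i * u (nx i) \<le> \<alpha> i * u i"
        using a[OF i(1)] b[OF i(1)] i(2) by (cases "0 < u (nx i)") auto
    qed
    then have "u j \<le> 0" "u (nx j) \<le> 0" using j nx_less by auto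
    with e[OF j] a[OF j] b[OF j] True nz show False by auto
  next
    case False
    then have c: "c > 0" using \<open>0 \<le> c\<close> by simp
    have prods: "0 < c * u (nx i) \<longleftrightarrow> 0 < u (nx i)" "c * u (nx i) < 0 \<longleftrightarrow> u (nx i) < 0" for i
      using c by (auto simp: zero_less_mult_iff mult_less_0_iff)
    \<comment> \<open>Here it is nonzero entries that travel forward, in contrast to the case of the
      minimum.\<close>
    have "u (nx i) \<noteq> 0" if "i < n" "u i \<noteq> 0" for i
      using e[OF that(1)] a[OF that(1)] b[OF that(1)] prods[of i] that(2) by (smt (verit))
    then have nz': "u i \<noteq> 0" if "i < n" for i
      using cyclic_induct[of j n "\<lambda>i. u i \<noteq> 0" i] that nz j by auto
    have m: "0 < u (nx i)" if "i < n" "\<sigma> i = -1" for i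
      using e[OF that(1)] a[OF that(1)] b[OF that(1)] prods[of i] that(2)
        nz'[OF that(1)] nz'[OF nx_less[of i]] by (smt (verit))
    obtain m where "m < n" "\<sigma> m = -1" using negative_row by auto
    with m have "0 < u (nx m)" by simp
    moreover have "u (nx m) \<le> 0"
    proof (rule some_nonpos[OF P nx_less])
      fix i assume i: "i < n" "0 < u i"
      show "0 < u (nx i) \<and> \<beta> i * u (nx i) \<le> \<alpha> i * u i"
        using e[OF i(1)] a[OF i(1)] b[OF i(1)] prods[of i] i(2) nz'[OF nx_less[of i]] by (smt (verit))
    qed
    ultimately show False by simp
  qed
qed

text \<open>A row of sign -1 makes its successor positive, since its left side is nonnegative.
  Positivity then spreads, and multiplying around the cycle is strict because of that same
  row.\<close>

lemma growing_orbit: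
  assumes x: "\<And>i. i < n \<Longrightarrow> 0 \<le> x i"
    and "\<And>i. i < n \<Longrightarrow> \<sigma> i = 1 \<Longrightarrow> \<alpha> i * x i = \<beta> i * x (nx i)"
    and "\<And>i. i < n \<Longrightarrow> \<sigma> i = -1 \<Longrightarrow> \<alpha> i * x i < \<beta> i * x (nx i)"
  shows "(\<Prod>i<n. \<alpha> i) < (\<Prod>i<n. \<beta> i)"
proof -
  have le: "\<alpha> i * x i \<le> \<beta> i * x (nx i)" if "i < n" for i
    using assms that sign[OF that] by (auto simp: less_imp_le)
  obtain m where m: "m < n" "\<sigma> m = -1" using negative_row by auto
  have next_pos: "0 < x (nx i)" if "i < n" "0 < \<beta> i * x (nx i)" for i
    using that \<beta>_pos[OF that(1)] by (simp add: zero_less_mult_iff)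
  have "0 \<le> \<alpha> m * x m" using \<alpha>_pos[OF m(1)] x[OF m(1)] by simp
  then have "0 < x (nx m)" using assms(3)[OF m] next_pos m by auto
  then have "0 < x i" if "i < n" for i
  proof (rule cyclic_induct[of "nx m" n "\<lambda>i. 0 < x i", OF nx_less _ _ that])
    fix i assume i: "i < n" "0 < x i"
    then have "0 < \<alpha> i * x i" using \<alpha>_pos by simp
    with le[OF i(1)] next_pos i show "0 < x (nx i)" by auto
  qed
  with le m assms(3) show ?thesis by (intro prod_less_around[of x m]) auto
qed

end

section \<open>Signed permutations of the sphere and their degree\<close>

definition signed_perm ::
  "nat \<Rightarrow> (nat \<Rightarrow> nat) \<Rightarrow> (nat \<Rightarrow> real) \<Rightarrow> (nat \<Rightarrow> real) \<Rightarrow> nat \<Rightarrow> real" where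
  "signed_perm n \<pi> s p = (\<lambda>i. if i < n then s i * p (\<pi> i) else p i)"

lemma continuous_map_signed_perm:
  assumes \<pi>: "bij_betw \<pi> {..<n} {..<n}" and s: "\<And>i. i < n \<Longrightarrow> (s i)\<^sup>2 = 1"
  shows "continuous_map (nsphere n) (nsphere n) (signed_perm n \<pi> s)"
proof -
  have "continuous_on S (\<lambda>p. if i < n then s i * p (\<pi> i) else p i)" for S and i :: nat
    by (cases "i < n") (auto intro!: continuous_on_mult continuous_on_const continuous_on_coord)
  then have "continuous_on S (signed_perm n \<pi> s)" for S
    unfolding signed_perm_def by (rule continuous_on_coordinatewise_then_product)
  moreover have "(\<Sum>i<n. (s i * p (\<pi> i))\<^sup>2) = (\<Sum>i<n. (p i)\<^sup>2)" for p :: "nat \<Rightarrow> real"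
  proof -
    have "(\<Sum>i<n. (s i * p (\<pi> i))\<^sup>2) = (\<Sum>i<n. (p (\<pi> i))\<^sup>2)"
      by (intro sum.cong) (auto simp: power_mult_distrib s)
    also have "\<dots> = (\<Sum>i<n. (p i)\<^sup>2)" by (rule sum.reindex_bij_betw[OF \<pi>])
    finally show ?thesis .
  qed
  ultimately show ?thesis by (auto simp: nsphere_top_of_set signed_perm_def)
qed

text \<open>Since the height is fixed, this is a signed coordinate permutation of the Euclidean
  space extended to its one-point compactification. It is a homeomorphism: the inverse uses the
  inverse permutation, with the signs transported along it.\<close>

lemma degree_signed_perm:
  assumes \<pi>: "bij_betw \<pi> {..<n} {..<n}" and s: "\<And>i. i < n \<Longrightarrow> (s i)\<^sup>2 = 1"
  shows "\<bar>Brouwer_degree2 n (signed_perm n \<pi> s)\<bar> = 1"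
proof -
  let ?\<rho> = "inv_into {..<n} \<pi>"
  have \<rho>: "bij_betw ?\<rho> {..<n} {..<n}" by (rule bij_betw_inv_into[OF \<pi>])
  have inv: "\<pi> (?\<rho> i) = i" "?\<rho> (\<pi> i) = i" "?\<rho> i < n" "\<pi> i < n" if "i < n" for i
    using that bij_betw_inv_into_right[OF \<pi>] bij_betw_inv_into_left[OF \<pi>]
      bij_betwE[OF \<pi>] bij_betwE[OF \<rho>] by auto
  have s': "s i * (s i * t) = t" if "i < n" for i t
    using s[OF that] by (simp add: power2_eq_square flip: mult.assoc)
  have "homeomorphic_maps (nsphere n) (nsphere n)
    (signed_perm n \<pi> s) (signed_perm n ?\<rho> (\<lambda>i. s (?\<rho> i)))"
    unfolding homeomorphic_maps_def
  proof (intro conjI ballI)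
    show "continuous_map (nsphere n) (nsphere n) (signed_perm n \<pi> s)"
      by (rule continuous_map_signed_perm[OF \<pi> s])
    show "continuous_map (nsphere n) (nsphere n) (signed_perm n ?\<rho> (\<lambda>i. s (?\<rho> i)))"
      by (rule continuous_map_signed_perm[OF \<rho>]) (simp add: s inv)
  qed (simp_all add: signed_perm_def fun_eq_iff inv s')
  then show ?thesis by (rule Brouwer_degree2_homeomorphic_maps)
qed

section \<open>Computing degrees and preimages through sphere maps\<close>

lemma stereographic_Euclidean: "n \<le> i \<Longrightarrow> stereographic n p i = 0"
  by (simp add: stereographic_def)

lemma sphere_map_at_zero:
  assumes bo: "bounded_open n \<Omega>" and 0: "(\<lambda>i. 0) \<in> \<Omega>" and n: "0 < n"
    and cf: "continuous_on UNIV f"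
    and nz: "\<And>x. (\<And>i. n \<le> i \<Longrightarrow> x i = 0) \<Longrightarrow> (\<And>i. i < n \<Longrightarrow> f x i = 0) \<Longrightarrow> x = (\<lambda>i. 0)"
  shows "0 < deg_radius n f \<Omega> (\<lambda>i. 0)"
    and "continuous_map (nsphere n) (nsphere n) (degree_sphere_map n f \<Omega> (\<lambda>i. 0))"
proof -
  have cf': "continuous_on (closure \<Omega>) f" by (rule continuous_on_subset[OF cf]) simp
  have o: "openin (Euclidean_space n) \<Omega>" using bo by (simp add: bounded_open_def)
  have ne: "\<exists>i<n. f x i \<noteq> 0" if "x \<in> closure \<Omega> - \<Omega>" for x
    using nz[of x] that 0 frontier_of_Euclidean(2)[OF o] by blast
  from nonempty_frontier[OF bo 0 n] obtain x where x: "x \<in> closure \<Omega> - \<Omega>" by auto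
  show "0 < deg_radius n f \<Omega> (\<lambda>i. 0)"
    by (rule deg_radius_pos_le(1)[OF bo cf' ne x])
  show "continuous_map (nsphere n) (nsphere n) (degree_sphere_map n f \<Omega> (\<lambda>i. 0))"
    by (rule continuous_degree_sphere_map[OF bo cf' ne])
qed

text \<open>
  The horizontal part of the sphere map of \<open>f\<close> is a nonnegative multiple of \<open>f\<close>, so the sphere maps
  of two maps that never point in opposite directions are nowhere antipodal, hence homotopic.
\<close>

lemma Brouwer_deg_eq_signed_perm:
  assumes bo: "bounded_open n \<Omega>" and 0: "(\<lambda>i. 0) \<in> \<Omega>" and n: "0 < n"
    and cf: "continuous_on UNIV f" and f0: "\<And>i. i < n \<Longrightarrow> f (\<lambda>i. 0) i = 0"
    and \<pi>: "bij_betw \<pi> {..<n} {..<n}" and s: "\<And>i. i < n \<Longrightarrow> (s i)\<^sup>2 = 1"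
    and no: "\<And>x c. (\<And>i. n \<le> i \<Longrightarrow> x i = 0) \<Longrightarrow> 0 \<le> c \<Longrightarrow>
       (\<And>i. i < n \<Longrightarrow> f x i = - c * (s i * x (\<pi> i))) \<Longrightarrow> x = (\<lambda>i. 0)"
  shows "Brouwer_deg n f \<Omega> (\<lambda>i. 0) = Brouwer_degree2 n (signed_perm n \<pi> s)"
proof -
  let ?F = "degree_sphere_map n f \<Omega> (\<lambda>i. 0)" and ?r = "deg_radius n f \<Omega> (\<lambda>i. 0)"
  have nz: "x = (\<lambda>i. 0)" if "\<And>i. n \<le> i \<Longrightarrow> x i = 0" "\<And>i. i < n \<Longrightarrow> f x i = 0" for x
    using no[of x 0] that by simp
  have r: "0 < ?r" and cF: "continuous_map (nsphere n) (nsphere n) ?F"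
    using sphere_map_at_zero[OF bo 0 n cf nz] by simp_all
  have "homotopic_with (\<lambda>x. True) (nsphere n) (nsphere n) ?F (signed_perm n \<pi> s)"
  proof (rule homotopic_non_antipodal[OF cF continuous_map_signed_perm[OF \<pi> s]])
    fix p assume p: "p \<in> topspace (nsphere n)"
    show "?F p \<noteq> (\<lambda>i. - signed_perm n \<pi> s p i)"
    proof
      assume "?F p = (\<lambda>i. - signed_perm n \<pi> s p i)"
      then have *: "?F p i = - signed_perm n \<pi> s p i" for i by (simp add: fun_eq_iff)
      have eq: "?F p i = - (s i * p (\<pi> i))" if "i < n" for i
        using *[of i] that by (simp add: signed_perm_def)
      have eqn: "?F p n = - p n" using *[of n] by (simp add: signed_perm_def)
      have sx: "s i * p (\<pi> i) = (1 - p n) * (s i * stereographic n p (\<pi> i))"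
        if "i < n" "p n < 1" for i
        using that bij_betwE[OF \<pi>] by (simp add: stereographic_def)
      let ?x = "stereographic n p"
      have opp: "False" if p1: "p n < 1" and "?x \<noteq> (\<lambda>i. 0)" "0 \<le> c" "\<And>i. i < n \<Longrightarrow> f ?x i = - c * (s i * ?x (\<pi> i))" for c
        using no[of ?x c] that stereographic_Euclidean by blast
      have lin: "?x = (\<lambda>i. 0)" if "p n < 1" "\<And>i. i < n \<Longrightarrow> s i * p (\<pi> i) = 0"
      proof
        fix i
        show "?x i = 0"
        proof (cases "i < n")
          case True
          then have "i \<in> \<pi> ` {..<n}" using \<pi> by (simp add: bij_betw_def)
          then obtain j where j: "j < n" "\<pi> j = i" by auto
          with that(2)[of j] s[of j] show ?thesis by (auto simp: stereographic_def)
        qed (simp add: stereographic_def)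
      qed
      show False
      proof (cases "p \<noteq> north_pole n \<and> ?x \<in> \<Omega>")
        \<comment> \<open>Here p is mapped to the north pole, so being antipodal makes p the south
          pole. Its projection is the origin, which lies in \<Omega>.\<close>
        case False
        then have F: "?F p = north_pole n" by (auto simp: degree_sphere_map_def)
        with eqn have pn: "p n = -1" by (simp add: north_pole_def)
        then have "?x = (\<lambda>i. 0)" using eq F by (intro lin) (simp_all add: north_pole_def)
        moreover have "p \<noteq> north_pole n" using pn by (auto simp: north_pole_def)
        ultimately show False using False 0 by simp
      next
        case True
        define w where "w = (\<lambda>i. f ?x i / ?r)"
        \<comment> \<open>The factor by which the collapse, including the division by the radius,
          multiplies \<open>f ?x\<close> in the horizontal coordinates.\<close>
        define c where "c = 2 * sqrt (max 0 (1 - (enorm n w)\<^sup>2)) / ?r"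
        have Fp: "?F p = ball_collapse n w" using True by (simp add: degree_sphere_map_def w_def)
        have h: "p n < 1" using True p sphere_height by auto
        have "c \<ge> 0" using r by (simp add: c_def)
        have c: "c * f ?x i = - (s i * p (\<pi> i))" if "i < n" for i
          using eq[OF that] that by (simp add: Fp ball_collapse_eq c_def w_def)
        show False
        proof (cases "?x = (\<lambda>i. 0)")
          \<comment> \<open>The origin is sent to the south pole, so p would have to be the north
            pole.\<close>
          case x0: True
          then have "w i = 0" if "i < n" for i using f0[OF that] by (simp add: w_def)
          then have "enorm n w = 0" by (simp add: enorm_def)
          then have "p n = 1" using eqn by (simp add: Fp ball_collapse_eq)
          with h show False by simp
        next
          case False
          then have "c \<noteq> 0" using c lin[OF h] by fastforce
          with \<open>c \<ge> 0\<close> have "c > 0" by simp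
          show False
          \<comment> \<open>Stereographic projection divides the horizontal coordinates of p by
            \<open>1 - p n\<close>; undoing this and dividing by c gives the multiple.\<close>
          proof (rule opp[OF h False, of "(1 - p n) / c"])
            show "0 \<le> (1 - p n) / c" using h \<open>c > 0\<close> by simp
            fix i assume "i < n"
            with c[OF this] sx[OF this h] \<open>c > 0\<close>
            show "f ?x i = - ((1 - p n) / c) * (s i * ?x (\<pi> i))" by (simp add: field_simps)
          qed
        qed
      qed
    qed
  qed
  from Brouwer_degree2_homotopic[OF this] show ?thesis by (simp only: Brouwer_deg_def)
qed

text \<open>A nonzero degree makes the sphere map surjective, so every horizontal direction is
  attained by a nonnegative multiple of a value of \<open>f\<close>. Homogeneity moves that multiple
  into the argument.\<close>

lemma homogeneous_surjective:
  assumes bo: "bounded_open n \<Omega>" and 0: "(\<lambda>i. 0) \<in> \<Omega>" and n: "0 < n"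
    and cf: "continuous_on UNIV f"
    and hom: "\<And>t x i. 0 \<le> t \<Longrightarrow> i < n \<Longrightarrow> f (\<lambda>i. t * x i) i = t * f x i"
    and nz: "\<And>x. (\<And>i. n \<le> i \<Longrightarrow> x i = 0) \<Longrightarrow> (\<And>i. i < n \<Longrightarrow> f x i = 0) \<Longrightarrow> x = (\<lambda>i. 0)"
    and deg: "Brouwer_deg n f \<Omega> (\<lambda>i. 0) \<noteq> 0"
  shows "\<exists>x. \<forall>i<n. f x i = z i"
proof (cases "\<exists>i<n. z i \<noteq> 0")
  case False
  with hom[of 0] show ?thesis by (intro exI[of _ "\<lambda>i. 0"]) auto
next
  case True
  let ?F = "degree_sphere_map n f \<Omega> (\<lambda>i. 0)" and ?r = "deg_radius n f \<Omega> (\<lambda>i. 0)"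
  have r: "0 < ?r" and cF: "continuous_map (nsphere n) (nsphere n) ?F"
    using sphere_map_at_zero[OF bo 0 n cf nz] by simp_all
  define e where "e = enorm n z"
  obtain j where j: "j < n" "z j \<noteq> 0" using True by auto
  then have "0 < (z j)\<^sup>2" by simp
  also have "(z j)\<^sup>2 \<le> (\<Sum>i<n. (z i)\<^sup>2)" using j by (intro member_le_sum) auto
  finally have e: "0 < e" by (simp add: e_def enorm_def)
  \<comment> \<open>The point of the equator in the direction of \<open>z\<close>: it is not the
    pole, so its preimage projects into \<Omega>.\<close>
  let ?y = "\<lambda>i. if i < n then z i / e else 0"
  have "(\<Sum>i<n. (z i / e)\<^sup>2) = 1"
    using e by (simp add: power_divide e_def enorm_sq flip: sum_divide_distrib)
      (simp add: enorm_def)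
  then have y: "?y \<in> topspace (nsphere n)" by (simp add: nsphere_top_of_set)
  have "?F ` topspace (nsphere n) = topspace (nsphere n)"
    using Brouwer_degree2_nonsurjective[OF cF] deg by (auto simp: Brouwer_deg_def)
  with y obtain p where p: "?F p = ?y" by (metis (lifting) imageE)
  let ?x = "stereographic n p"
  have "?y \<noteq> north_pole n" by (auto simp: north_pole_def fun_eq_iff)
  with p have "p \<noteq> north_pole n \<and> ?x \<in> \<Omega>" by (auto simp: degree_sphere_map_def split: if_splits)
  with p have b: "ball_collapse n (\<lambda>i. f ?x i / ?r) = ?y" by (simp add: degree_sphere_map_def)
  define c where "c = 2 * sqrt (max 0 (1 - (enorm n (\<lambda>i. f ?x i / ?r))\<^sup>2)) / ?r"
  have "0 \<le> c" using r by (simp add: c_def)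
  have "c * f ?x i = z i / e" if "i < n" for i
    using fun_cong[OF b, of i] that by (simp add: ball_collapse_eq c_def)
  then have "f (\<lambda>i. e * c * ?x i) i = z i" if "i < n" for i
    using hom[of "e * c" i ?x] that e \<open>0 \<le> c\<close> by (simp add: mult.assoc)
  then show ?thesis by blast
qed

lemma bounded_open_unit_ball:
  "bounded_open n {x. (\<forall>i\<ge>n. x i = 0) \<and> enorm n x < 1}"
proof -
  have "open {x. enorm n x < 1}"
    by (intro open_Collect_less continuous_on_enorm continuous_on_id continuous_on_const)
  then have "openin (top_of_set {x. \<forall>i\<ge>n. x i = 0}) ({x. \<forall>i\<ge>n. x i = 0} \<inter> {x. enorm n x < 1})"
    by (rule openin_open_Int)
  then show ?thesis
    by (auto simp: bounded_open_def Euclidean_space_top_of_set Int_def intro!: exI[of _ 1])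
qed

lemma eq_zero_fun:
  fixes x :: "nat \<Rightarrow> real"
  assumes "\<And>i. n \<le> i \<Longrightarrow> x i = 0" "\<And>i. i < n \<Longrightarrow> x i = 0"
  shows "x = (\<lambda>i. 0)"
  using assms by (metis not_le)

section \<open>Degrees of the two maps attached to a signed cycle\<close>

context signed_cycle
begin

text \<open>The value 0 from index n on makes this equal to \<open>min_map A\<close> as a function,
  not only on the coordinates below n.\<close>

definition min_row :: "(nat \<Rightarrow> real) \<Rightarrow> nat \<Rightarrow> real" where
  "min_row x i = (if i < n then min (x i) (signed_row x i) else 0)"

lemma continuous_min_row: "continuous_on UNIV min_row"
proof (rule continuous_on_coordinatewise_then_product)
  fix i show "continuous_on UNIV (\<lambda>x. min_row x i)"
    by (cases "i < n") (auto simp: min_row_def signed_row_def intro!: continuous_intros continuous_on_coord)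
qed

lemma continuous_comp_map: "continuous_on UNIV comp_map"
proof (rule continuous_on_coordinatewise_then_product)
  fix i show "continuous_on UNIV (\<lambda>x. comp_map x i)"
    by (cases "i < n") (auto simp: comp_map_def signed_row_def intro!: continuous_intros continuous_on_coord)
qed

lemma signed_row_scale: "signed_row (\<lambda>i. t * x i) i = t * signed_row x i"
  by (simp add: signed_row_def algebra_simps)

lemma min_row_scale: "0 \<le> t \<Longrightarrow> min_row (\<lambda>i. t * x i) i = t * min_row x i"
  by (simp add: min_row_def signed_row_scale min_mult_distrib_left)

lemma comp_map_scale: "0 \<le> t \<Longrightarrow> comp_map (\<lambda>i. t * x i) i = t * comp_map x i"
proof -
  assume t: "0 \<le> t"
  then have m: "max 0 (t * y) = t * max 0 y" for y by (simp add: max_mult_distrib_left)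
  from m[of "- x i"] show ?thesis by (simp add: comp_map_def m signed_row_scale right_diff_distrib)
qed

lemma sign_sq: "i < n \<Longrightarrow> (\<sigma> i)\<^sup>2 = 1"
  using sign by fastforce

text \<open>The right side does not involve \<Omega>, so this also shows that the matrix degree is
  well defined in this case.\<close>

lemma Brouwer_deg_min_row:
  assumes P: "(\<Prod>i<n. \<alpha> i) < (\<Prod>i<n. \<beta> i)" and "bounded_open n \<Omega>" "(\<lambda>i. 0) \<in> \<Omega>"
  shows "Brouwer_deg n min_row \<Omega> (\<lambda>i. 0) = Brouwer_degree2 n (signed_perm n nx (\<lambda>i. - \<sigma> i))"
proof (rule Brouwer_deg_eq_signed_perm[OF assms(2,3) n_pos continuous_min_row])
  fix x c assume x: "\<And>i. n \<le> i \<Longrightarrow> x i = 0" and c: "0 \<le> c"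
    and eq: "\<And>i. i < n \<Longrightarrow> min_row x i = - c * (- \<sigma> i * x (nx i))"
  have eq': "min (x i) (signed_row x i) = - c * (- \<sigma> i * x (nx i))" if "i < n" for i
    using eq[OF that] that by (simp add: min_row_def)
  have "x j = 0" if "j < n" for j by (rule min_row_not_opposite[OF P c _ that]) (rule eq')
  with x show "x = (\<lambda>i. 0)" by (rule eq_zero_fun)
qed (simp_all add: min_row_def signed_row_def sign_sq bij_betw_Suc_mod n_pos)

lemma Brouwer_deg_comp_map:
  assumes P: "(\<Prod>i<n. \<alpha> i) < (\<Prod>i<n. \<beta> i)" and "bounded_open n \<Omega>" "(\<lambda>i. 0) \<in> \<Omega>"
  shows "Brouwer_deg n comp_map \<Omega> (\<lambda>i. 0) = Brouwer_degree2 n (signed_perm n nx \<sigma>)"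
proof (rule Brouwer_deg_eq_signed_perm[OF assms(2,3) n_pos continuous_comp_map])
  fix x c assume x: "\<And>i. n \<le> i \<Longrightarrow> x i = 0" and c: "0 \<le> c"
    and eq: "\<And>i. i < n \<Longrightarrow> comp_map x i = - c * (\<sigma> i * x (nx i))"
  have "x j = 0" if "j < n" for j by (rule comp_map_not_opposite[OF P c _ that]) (rule eq)
  with x show "x = (\<lambda>i. 0)" by (rule eq_zero_fun)
qed (simp_all add: comp_map_def signed_row_def sign_sq bij_betw_Suc_mod n_pos)

lemma abs_Brouwer_degree2_shift:
  "\<bar>Brouwer_degree2 n (signed_perm n nx \<sigma>)\<bar> = 1"
  "\<bar>Brouwer_degree2 n (signed_perm n nx (\<lambda>i. - \<sigma> i))\<bar> = 1"
  by (rule degree_signed_perm; simp add: sign_sq bij_betw_Suc_mod n_pos)+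

lemma comp_map_surjective:
  assumes P: "(\<Prod>i<n. \<alpha> i) < (\<Prod>i<n. \<beta> i)"
  shows "\<exists>u. \<forall>i<n. comp_map u i = q i"
proof -
  let ?\<Omega> = "{x. (\<forall>i\<ge>n. x i = 0) \<and> enorm n x < 1}"
  have 0: "(\<lambda>i. 0) \<in> ?\<Omega>" by (simp add: enorm_def)
  show ?thesis
  proof (rule homogeneous_surjective[OF bounded_open_unit_ball 0 n_pos continuous_comp_map comp_map_scale])
    show "Brouwer_deg n comp_map ?\<Omega> (\<lambda>i. 0) \<noteq> 0"
      using Brouwer_deg_comp_map[OF P bounded_open_unit_ball 0] abs_Brouwer_degree2_shift(1) by auto
    fix x assume x: "\<And>i. n \<le> i \<Longrightarrow> x i = 0" and eq: "\<And>i. i < n \<Longrightarrow> comp_map x i = 0"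
    have "x j = 0" if "j < n" for j
      by (rule comp_map_not_opposite[OF P order_refl _ that]) (simp add: eq)
    with x show "x = (\<lambda>i. 0)" by (rule eq_zero_fun)
  qed
qed

text \<open>The common consequence of \<open>min x (A x) = z\<close> and of the complementarity
  problem for \<open>- z\<close>, with z the indicator of the rows of sign -1.\<close>

lemma prod_less_of_solution:
  assumes x: "\<And>i. i < n \<Longrightarrow> 0 \<le> x i"
    and 0: "\<And>i. i < n \<Longrightarrow> \<sigma> i = 1 \<Longrightarrow> min (x i) (signed_row x i) = 0"
    and 1: "\<And>i. i < n \<Longrightarrow> \<sigma> i = -1 \<Longrightarrow> 1 \<le> signed_row x i"
  shows "(\<Prod>i<n. \<alpha> i) < (\<Prod>i<n. \<beta> i)"
proof (rule growing_orbit[OF x])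
  fix i assume i: "i < n" "\<sigma> i = 1"
  \<comment> \<open>If \<open>x i\<close> is positive the row vanishes; if it is 0, nonnegativity of
    the row forces the other term to be 0 as well.\<close>
  have "0 \<le> \<beta> i * x (nx i)" using \<beta>_pos[OF i(1)] x[OF nx_less[of i]] by simp
  with 0[OF i] show "\<alpha> i * x i = \<beta> i * x (nx i)"
    by (cases "x i = 0") (auto simp: signed_row_def i min_def split: if_splits)
next
  fix i assume i: "i < n" "\<sigma> i = -1"
  with 1[OF i] show "\<alpha> i * x i < \<beta> i * x (nx i)" by (simp add: signed_row_def)
qed

lemma Brouwer_deg_min_row_0:
  assumes P: "(\<Prod>i<n. \<beta> i) \<le> (\<Prod>i<n. \<alpha> i)"
    and bo: "bounded_open n \<Omega>" and 0: "(\<lambda>i. 0) \<in> \<Omega>"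
    and nz: "\<And>x. (\<And>i. n \<le> i \<Longrightarrow> x i = 0) \<Longrightarrow> (\<And>i. i < n \<Longrightarrow> min_row x i = 0) \<Longrightarrow> x = (\<lambda>i. 0)"
  shows "Brouwer_deg n min_row \<Omega> (\<lambda>i. 0) = 0"
proof (rule ccontr)
  assume "\<not> ?thesis"
  then have "\<exists>x. \<forall>i<n. min_row x i = (if \<sigma> i = -1 then 1 else 0)"
    by (intro homogeneous_surjective[OF bo 0 n_pos continuous_min_row min_row_scale nz])
  then obtain x where x: "\<And>i. i < n \<Longrightarrow> min_row x i = (if \<sigma> i = -1 then 1 else 0)" by blast
  have "(\<Prod>i<n. \<alpha> i) < (\<Prod>i<n. \<beta> i)"
  proof (rule prod_less_of_solution)
    fix i assume i: "i < n"
    show "0 \<le> x i" using x[OF i] by (auto simp: i min_row_def min_def split: if_splits)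
    show "min (x i) (signed_row x i) = 0" if "\<sigma> i = 1" using x[OF i] that by (simp add: i min_row_def)
    show "1 \<le> signed_row x i" if "\<sigma> i = -1" using x[OF i] that by (simp add: i min_row_def)
  qed
  with P show False by simp
qed

end

section \<open>Type-IV matrices as signed cycles\<close>

lemma det_bdsw:
  assumes A: "A \<in> carrier_mat n n" and "bdsw A"
  shows "det A = (\<Prod>i<n. A $$ (i, i)) + (-1) ^ (n + 1) * (\<Prod>i<n. A $$ (i, Suc i mod n))"
proof -
  have n2: "2 \<le> n" using assms by (auto simp: bdsw_def)
  then obtain m where n: "n = Suc m" and m: "0 < m" by (cases n) auto
  have z: "A $$ (i, j) = 0" if "i < n" "j < n" "j \<noteq> i" "j \<noteq> Suc i" "i \<noteq> m \<or> j \<noteq> 0" for i j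
    using assms that by (auto simp: bdsw_def n)
  \<comment> \<open>The first column has entries only in its first and last rows. Deleting the first
    row leaves an upper triangular minor, deleting the last a lower triangular one with the
    superdiagonal of A on its diagonal.\<close>
  have "det A = (\<Sum>i<n. A $$ (i, 0) * cofactor A i 0)"
    by (rule laplace_expansion_column[OF A]) (simp add: n)
  also have "\<dots> = (\<Sum>i\<in>{0, m}. A $$ (i, 0) * cofactor A i 0)"
    by (rule sum.mono_neutral_right) (use z n in auto)
  also have "\<dots> = A $$ (0, 0) * cofactor A 0 0 + A $$ (m, 0) * cofactor A m 0" using m by simp
  also have "cofactor A 0 0 = (\<Prod>i<m. A $$ (Suc i, Suc i))"
  proof -
    have "det (mat_delete A 0 0) = prod_list (diag_mat (mat_delete A 0 0))"
      by (rule det_upper_triangular[of _ m])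
        (use A z n in \<open>auto simp: mat_delete_def upper_triangular_def\<close>)
    then show ?thesis using A n
      by (simp add: cofactor_def prod_list_diag_prod mat_delete_def atLeast0LessThan)
  qed
  also have "cofactor A m 0 = (-1) ^ m * (\<Prod>i<m. A $$ (i, Suc i))"
  proof -
    have "det (mat_delete A m 0) = prod_list (diag_mat (mat_delete A m 0))"
      by (rule det_lower_triangular[of m])
        (use A z n in \<open>auto simp: mat_delete_def\<close>)
    then show ?thesis using A n
      by (simp add: cofactor_def prod_list_diag_prod mat_delete_def atLeast0LessThan)
  qed
  finally have "det A = A $$ (0, 0) * (\<Prod>i<m. A $$ (Suc i, Suc i)) +
    A $$ (m, 0) * ((-1) ^ m * (\<Prod>i<m. A $$ (i, Suc i)))" .
  moreover have "(\<Prod>i<n. A $$ (i, i)) = A $$ (0, 0) * (\<Prod>i<m. A $$ (Suc i, Suc i))"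
    by (simp add: n prod.lessThan_Suc_shift del: prod.lessThan_Suc)
  moreover have "(\<Prod>i<m. A $$ (i, Suc i mod n)) = (\<Prod>i<m. A $$ (i, Suc i))"
    by (intro prod.cong) (auto simp: n)
  then have "(\<Prod>i<n. A $$ (i, Suc i mod n)) = (\<Prod>i<m. A $$ (i, Suc i)) * A $$ (m, 0)"
    by (simp add: n)
  ultimately show ?thesis by (simp add: n)
qed

lemma bdsw_mult_vec:
  assumes A: "A \<in> carrier_mat n n" and "bdsw A" "x \<in> carrier_vec n" "i < n"
  shows "(A *\<^sub>v x) $ i = A $$ (i, i) * x $ i + A $$ (i, Suc i mod n) * x $ (Suc i mod n)"
proof -
  have n2: "2 \<le> n" using assms by (auto simp: bdsw_def)
  \<comment> \<open>With at least two indices, i and its successor are distinct, so the row sum has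
    two separate terms.\<close>
  then have ne: "i \<noteq> Suc i mod n" "Suc i mod n < n" using \<open>i < n\<close> by (auto simp: mod_Suc)
  have "(A *\<^sub>v x) $ i = (\<Sum>j\<in>{0..<n}. A $$ (i, j) * x $ j)"
    using assms by (simp add: scalar_prod_def)
  also have "\<dots> = (\<Sum>j\<in>{i, Suc i mod n}. A $$ (i, j) * x $ j)"
  proof (rule sum.mono_neutral_right)
    show "\<forall>j\<in>{0..<n} - {i, Suc i mod n}. A $$ (i, j) * x $ j = 0"
    proof
      fix j assume j: "j \<in> {0..<n} - {i, Suc i mod n}"
      have "A $$ (i, j) = 0"
      proof (rule ccontr)
        assume "A $$ (i, j) \<noteq> 0"
        then have "j = i \<or> j = i + 1 \<or> (i = n - 1 \<and> j = 0)"
          using assms j by (auto simp: bdsw_def)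
        with j \<open>i < n\<close> show False by (auto simp: mod_Suc split: if_splits)
      qed
      then show "A $$ (i, j) * x $ j = 0" by simp
    qed
  qed (use \<open>i < n\<close> ne in auto)
  finally show ?thesis using ne by simp
qed

lemma type_IV_bdsw_signs:
  assumes A: "A \<in> carrier_mat n n" and IV: "type_IV_bdsw A" and i: "i < n"
  shows "A $$ (i, i) > 0 \<and> A $$ (i, Suc i mod n) < 0 \<or> A $$ (i, i) < 0 \<and> A $$ (i, Suc i mod n) > 0"
proof -
  have "j = i \<or> j = Suc i mod n" if "j < n" "A $$ (i, j) \<noteq> 0" for j
  proof -
    have "j = i \<or> j = i + 1 \<or> (i = n - 1 \<and> j = 0)"
      using IV A i that by (auto simp: type_IV_bdsw_def bdsw_def)
    with i that show ?thesis by auto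
  qed
  moreover have "\<exists>j<n. A $$ (i, j) < 0" "\<exists>j<n. A $$ (i, j) > 0"
    using IV A i by (simp_all add: type_IV_bdsw_def not_le)
  ultimately show ?thesis by (metis less_numeral_extra(3) less_asym)
qed

text \<open>Take absolute values and the diagonal signs. The signs contribute
  \<open>(-1) ^ k\<close> to the diagonal product and \<open>(-1) ^ n * (-1) ^ k\<close> to the
  other; the latter meets \<open>(-1) ^ (n + 1)\<close> from the determinant, so the two products
  enter with opposite signs.\<close>

lemma type_IV_bdsw_signed_cycle:
  fixes A :: "real mat"
  assumes A: "A \<in> carrier_mat n n" and IV: "type_IV_bdsw A"
  obtains \<alpha> \<beta> \<sigma> where "signed_cycle n \<alpha> \<beta> \<sigma>"
    and "\<forall>x\<in>carrier_vec n. \<forall>i<n. (A *\<^sub>v x) $ i = signed_cycle.signed_row n \<alpha> \<beta> \<sigma> (\<lambda>j. x $ j) i"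
    and "(-1) ^ (card {i. i < n \<and> A $$ (i, i) < 0} + 1) * det A = (\<Prod>i<n. \<beta> i) - (\<Prod>i<n. \<alpha> i)"
proof
  let ?a = "\<lambda>i. A $$ (i, i)" and ?b = "\<lambda>i. A $$ (i, Suc i mod n)"
  let ?\<alpha> = "\<lambda>i. \<bar>?a i\<bar>" and ?\<beta> = "\<lambda>i. \<bar>?b i\<bar>" and ?\<sigma> = "\<lambda>i. if ?a i < 0 then -1 else 1 :: real"
  let ?k = "card {i. i < n \<and> ?a i < 0}"
  have bd: "bdsw A" using IV by (simp add: type_IV_bdsw_def)
  note signs = type_IV_bdsw_signs[OF A IV]
  have a: "?a i = ?\<sigma> i * ?\<alpha> i" and b: "?b i = - 1 * ?\<sigma> i * ?\<beta> i" if "i < n" for i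
    using signs[OF that] by auto
  show sc: "signed_cycle n ?\<alpha> ?\<beta> ?\<sigma>"
  proof
    show "0 < n" using bd A by (auto simp: bdsw_def)
    show "\<exists>m<n. ?\<sigma> m = -1" using IV A by (auto simp: type_IV_bdsw_def)
  qed (use signs in force)+
  have "(A *\<^sub>v x) $ i = signed_cycle.signed_row n ?\<alpha> ?\<beta> ?\<sigma> (\<lambda>j. x $ j) i" if "x \<in> carrier_vec n" "i < n" for x i
    using signs[OF that(2)] by (auto simp: bdsw_mult_vec[OF A bd that] signed_cycle.signed_row_def[OF sc])
  then show "\<forall>x\<in>carrier_vec n. \<forall>i<n. (A *\<^sub>v x) $ i = signed_cycle.signed_row n ?\<alpha> ?\<beta> ?\<sigma> (\<lambda>j. x $ j) i"
    by blast
  have "(\<Prod>i<n. ?\<sigma> i) = (\<Prod>i | i \<in> {..<n} \<and> ?a i < 0. -1)"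
    by (rule prod.inter_filter[symmetric]) simp
  then have sg: "(\<Prod>i<n. ?\<sigma> i) = (-1) ^ ?k" by simp
  have "(\<Prod>i<n. ?a i) = (\<Prod>i<n. ?\<sigma> i * ?\<alpha> i)" by (intro prod.cong refl a) simp
  also have "\<dots> = (-1) ^ ?k * (\<Prod>i<n. ?\<alpha> i)" by (simp only: prod.distrib sg)
  finally have pa: "(\<Prod>i<n. ?a i) = (-1) ^ ?k * (\<Prod>i<n. ?\<alpha> i)" .
  have "(\<Prod>i<n. ?b i) = (\<Prod>i<n. -1 * ?\<sigma> i * ?\<beta> i)" by (intro prod.cong refl b) simp
  also have "\<dots> = (-1) ^ n * (-1) ^ ?k * (\<Prod>i<n. ?\<beta> i)" by (simp only: prod.distrib sg) simp
  finally have pb: "(\<Prod>i<n. ?b i) = (-1) ^ n * (-1) ^ ?k * (\<Prod>i<n. ?\<beta> i)" .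
  have sq: "(-1 :: real) ^ j * ((-1) ^ j * t) = t" for j t
    by (simp flip: mult.assoc power_add)
  show "(-1) ^ (?k + 1) * det A = (\<Prod>i<n. ?\<beta> i) - (\<Prod>i<n. ?\<alpha> i)"
    unfolding det_bdsw[OF A bd] pa pb by (simp add: ring_distribs sq mult.assoc mult.left_commute)
qed

section \<open>Complementarity as a componentwise minimum, and the degree of a matrix\<close>

lemma LCP_solution_iff:
  assumes "A \<in> carrier_mat n n" "q \<in> carrier_vec n"
  shows "LCP_solution A q x \<longleftrightarrow>
    x \<in> carrier_vec n \<and> (\<forall>i<n. min (x $ i) ((A *\<^sub>v x) $ i + q $ i) = 0)"
proof (cases "x \<in> carrier_vec n")
  case x: True
  let ?w = "A *\<^sub>v x + q"
  have w: "?w $ i = (A *\<^sub>v x) $ i + q $ i" if "i < n" for i using assms x that by simp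
  have le: "0\<^sub>v n \<le> v \<longleftrightarrow> (\<forall>i<n. 0 \<le> v $ i)" if "v \<in> carrier_vec n" for v :: "real vec"
    using that by (auto simp: less_eq_vec_def)
  have wc: "?w \<in> carrier_vec n" using assms x by simp
  have "x \<bullet> ?w = (\<Sum>i\<in>{0..<n}. x $ i * ?w $ i)" using wc by (simp only: scalar_prod_def carrier_vecD)
  \<comment> \<open>Under nonnegativity every summand of the inner product is nonnegative, so it
    vanishes only termwise.\<close>
  moreover have "(\<Sum>i\<in>{0..<n}. x $ i * ?w $ i) = 0 \<longleftrightarrow> (\<forall>i<n. x $ i * ?w $ i = 0)"
    if "\<forall>i<n. 0 \<le> x $ i" "\<forall>i<n. 0 \<le> ?w $ i"
  proof -
    have "0 \<le> x $ i * ?w $ i" if "i \<in> {0..<n}" for i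
      using \<open>\<forall>i<n. 0 \<le> x $ i\<close> \<open>\<forall>i<n. 0 \<le> ?w $ i\<close> that by (intro mult_nonneg_nonneg) auto
    then have "(\<Sum>i\<in>{0..<n}. x $ i * ?w $ i) = 0 \<longleftrightarrow> (\<forall>i\<in>{0..<n}. x $ i * ?w $ i = 0)"
      by (intro sum_nonneg_eq_0_iff) auto
    then show ?thesis by (simp add: Ball_def del: index_add_vec)
  qed
  ultimately have "LCP_solution A q x \<longleftrightarrow>
    (\<forall>i<n. 0 \<le> x $ i) \<and> (\<forall>i<n. 0 \<le> ?w $ i) \<and> (\<forall>i<n. x $ i * ?w $ i = 0)"
    using assms x le[OF x] le[OF wc] by (auto simp: LCP_solution_def)
  also have "\<dots> \<longleftrightarrow> (\<forall>i<n. min (x $ i) (?w $ i) = 0)"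
  proof -
    have "min a b = 0 \<longleftrightarrow> 0 \<le> a \<and> 0 \<le> b \<and> a * b = 0" for a b :: real by (auto simp: min_def)
    then show ?thesis by blast
  qed
  finally show ?thesis using x w by auto
qed (use assms in \<open>auto simp: LCP_solution_def\<close>)

text \<open>The unit ball is an admissible domain, so the condition in the definite description is
  not vacuous and determines the value.\<close>

lemma mat_degree_eqI:
  assumes "\<And>\<Omega>. bounded_open (dim_row A) \<Omega> \<Longrightarrow> (\<lambda>i. 0) \<in> \<Omega> \<Longrightarrow>
    Brouwer_deg (dim_row A) (min_map A) \<Omega> (\<lambda>i. 0) = d"
  shows "mat_degree A = d"
  unfolding mat_degree_def
proof (rule the_equality)
  let ?\<Omega> = "{x. (\<forall>i\<ge>dim_row A. x i = 0) \<and> enorm (dim_row A) x < 1}"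
  fix d' assume d': "\<forall>\<Omega>. bounded_open (dim_row A) \<Omega> \<and> (\<lambda>i. 0) \<in> \<Omega> \<longrightarrow>
     Brouwer_deg (dim_row A) (min_map A) \<Omega> (\<lambda>i. 0) = d'"
  have "bounded_open (dim_row A) ?\<Omega>" "(\<lambda>i. 0) \<in> ?\<Omega>"
    using bounded_open_unit_ball by (auto simp: enorm_def)
  with assms[of ?\<Omega>] d' show "d' = d" by blast
qed (use assms in auto)

section \<open>The three equivalent conditions\<close>

theorem theorem8p1:
  fixes A :: "real mat" and n k :: nat
  assumes "n \<ge> 2"
    and "A \<in> carrier_mat n n"
    and "type_IV_bdsw A"
    and "k = card {i. i < n \<and> A $$ (i, i) < 0}"
  shows "(Q_matrix A \<longleftrightarrow> (-1) ^ (k + 1) * det A > 0) \<and>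
         ((-1) ^ (k + 1) * det A > 0 \<longleftrightarrow> R0_matrix A \<and> (mat_degree A = 1 \<or> mat_degree A = -1))"
proof -
  note A = assms(2)
  obtain \<alpha> \<beta> \<sigma> where sc: "signed_cycle n \<alpha> \<beta> \<sigma>"
    and mult: "\<forall>x\<in>carrier_vec n. \<forall>i<n.
      (A *\<^sub>v x) $ i = signed_cycle.signed_row n \<alpha> \<beta> \<sigma> (\<lambda>j. x $ j) i"
    and dt: "(-1) ^ (k + 1) * det A = (\<Prod>i<n. \<beta> i) - (\<Prod>i<n. \<alpha> i)"
    by (rule type_IV_bdsw_signed_cycle[OF assms(2,3), folded assms(4)]) blast
  interpret signed_cycle n \<alpha> \<beta> \<sigma> by (rule sc)
  \<comment> \<open>A row reads only the indices below n, so functions can be exchanged for vectors,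
    which agree with them there.\<close>
  have signed_row_cong: "signed_row x i = signed_row y i" if "\<And>j. j < n \<Longrightarrow> x j = y j" "i < n" for x y i
    using that nx_less by (simp add: signed_row_def)
  have mult_vec: "(A *\<^sub>v vec n x) $ i = signed_row x i" if "i < n" for x i
    using mult signed_row_cong[of "\<lambda>j. vec n x $ j" x i] that by simp
  have mm: "min_map A = min_row"
    using A by (auto simp: min_map_def min_row_def fun_eq_iff mult_vec simp del: index_mult_mat_vec)
  have lcp: "LCP_solution A q x \<longleftrightarrow> x \<in> carrier_vec n \<and>
     (\<forall>i<n. min (x $ i) (signed_row (\<lambda>j. x $ j) i + q $ i) = 0)" if "q \<in> carrier_vec n" for q x
    using LCP_solution_iff[OF A that] mult by auto
  have R0: "R0_matrix A \<longleftrightarrow> (\<forall>x\<in>carrier_vec n. (\<forall>i<n. min (x $ i) (signed_row (\<lambda>j. x $ j) i) = 0) \<longrightarrow> x = 0\<^sub>v n)"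
    using A by (auto simp: R0_matrix_def lcp signed_row_def)
  have nz: "x = (\<lambda>i. 0)" if "R0_matrix A" and x: "\<And>i. n \<le> i \<Longrightarrow> x i = 0" "\<And>i. i < n \<Longrightarrow> min_row x i = 0" for x
  proof -
    have "vec n x = 0\<^sub>v n"
      using that(1) x(2) signed_row_cong[of "\<lambda>j. vec n x $ j" x] unfolding R0 by (auto simp: min_row_def)
    then have "x i = 0" if "i < n" for i using that by (metis index_vec index_zero_vec(1))
    with x(1) show ?thesis by (rule eq_zero_fun)
  qed
  show ?thesis
  proof (cases "(\<Prod>i<n. \<alpha> i) < (\<Prod>i<n. \<beta> i)")
    case P: True
    have "Q_matrix A" unfolding Q_matrix_def
    proof
      fix q :: "real vec" assume "q \<in> carrier_vec (dim_row A)"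
      then have q: "q \<in> carrier_vec n" using A by simp
      obtain u where u: "\<And>i. i < n \<Longrightarrow> comp_map u i = q $ i"
        using comp_map_surjective[OF P, of "\<lambda>i. q $ i"] by blast
      let ?x = "\<lambda>i. max 0 (u i)"
      \<comment> \<open>The slack of the candidate solution is the negative part of
        \<open>u\<close>, whose minimum with the positive part is 0.\<close>
      have "signed_row ?x i + q $ i = max 0 (- u i)" if "i < n" for i
        using u[OF that] that by (simp add: comp_map_def)
      then have "LCP_solution A q (vec n ?x)"
        using signed_row_cong[of "\<lambda>j. vec n ?x $ j" ?x] by (auto simp: lcp[OF q])
      then show "\<exists>x. LCP_solution A q x" ..
    qed
    moreover have "R0_matrix A" unfolding R0
      using min_row_zero[OF P] by (auto intro!: eq_vecI)
    moreover have "mat_degree A = Brouwer_degree2 n (signed_perm n nx (\<lambda>i. - \<sigma> i))"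
      using A Brouwer_deg_min_row[OF P] by (intro mat_degree_eqI) (simp add: mm)
    then have "mat_degree A = 1 \<or> mat_degree A = -1" using abs_Brouwer_degree2_shift(2) by linarith
    ultimately show ?thesis using P unfolding dt by simp
  next
    case False
    then have P: "(\<Prod>i<n. \<beta> i) \<le> (\<Prod>i<n. \<alpha> i)" by simp
    have "\<not> Q_matrix A"
    proof
      assume Q: "Q_matrix A"
      \<comment> \<open>This is \<open>- z\<close>; in the rows of sign -1 feasibility demands a row
        value of at least 1.\<close>
      let ?q = "vec n (\<lambda>i. if \<sigma> i = -1 then -1 else 0)"
      have "?q \<in> carrier_vec (dim_row A)" using A by simp
      with Q obtain x where "LCP_solution A ?q x" unfolding Q_matrix_def by blast
      then have x: "min (x $ i) (signed_row (\<lambda>j. x $ j) i + (if \<sigma> i = -1 then -1 else 0)) = 0" if "i < n" for i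
        using that by (auto simp: lcp)
      have "(\<Prod>i<n. \<alpha> i) < (\<Prod>i<n. \<beta> i)"
      proof (rule prod_less_of_solution[of "\<lambda>j. x $ j"])
        fix i assume i: "i < n"
        show "0 \<le> x $ i" using x[OF i] by linarith
        show "min (x $ i) (signed_row (\<lambda>j. x $ j) i) = 0" if "\<sigma> i = 1" using x[OF i] that by simp
        show "1 \<le> signed_row (\<lambda>j. x $ j) i" if "\<sigma> i = -1" using x[OF i] that by simp
      qed
      with False show False ..
    qed
    moreover have "mat_degree A = 0" if "R0_matrix A"
      using A Brouwer_deg_min_row_0[OF P _ _ nz[OF that]] by (intro mat_degree_eqI) (simp add: mm)
    ultimately show ?thesis using P unfolding dt by auto
  qed
qed

end
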